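(* Consider a deep belief network (DBN) with $L$ layers, each layer containing $n$ units with state spaces of finite cardinalities $q_1,\ldots,q_n\ge 2$. Let $m$ be any integer with $\prod_{j=m+2}^{n}q_j\leq m\leq n$ (an empty product being $1$), and let $q_1\geq \cdots\geq q_m$. If $$L\geq 2+\frac{q_1^S-1}{q_1-1}$$ for some $S\in\{0,1,\ldots,m\}$, then $$D_{\mathrm{DBN}}\leq \log\Big(\prod_{j=1}^{m-S}q_j\Big).$$ In particular, when all units are binary and the network has $L\geq 1+2^S$ layers of size $n=2^{k-1}+k$, for some integer $k\ge 1$ and some $S\in\{0,1,\ldots,2^{k-1}\}$, then $$D_{\mathrm{DBN}} \leq ( 2^{k-1} - S )\log(2).$$
   Context: Kullback-Leibler divergence: for probability distributions $p,q$ on a finite set $\mathcal{X}$, $D(p\|q)=\sum_x p(x)\log\frac{p(x)}{q(x)}$. The base of the logarithm is arbitrary, but the same in the definition of $D$ and in the bounds. For a set $\mathcal{M}$ of probability distributions on $\mathcal{X}$, $D(p\|\mathcal{M})=\inf_{q\in\mathcal{M}}D(p\|q)$, and $D_{\mathcal{M}}=\max_{p}D(p\|\mathcal{M})$, the maximum being over all probability distributions $p$ on $\mathcal{X}$. $D_{\mathrm{DBN}}$ denotes $D_{\mathcal{M}}$ for the DBN model $\mathcal{M}$ described next. Deep belief network: a layered stochastic network with layers $1,\dots,L$ ($L\ge2$). The first layer is the only visible layer, so $L$ counts all layers including the visible one. Each layer $l$ has $n$ units $h^{(l)}=(h^{(l)}_1,\dots,h^{(l)}_n)$, where $h^{(l)}_i$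 takes values in a set $\mathcal{X}_i$ with $|\mathcal{X}_i|=q_i$. The visible state space is $\mathcal{X}=\mathcal{X}_1\times\cdots\times\mathcal{X}_n$. The interactions between the two deepest layers $L-1$ and $L$ are undirected and bipartite (a restricted Boltzmann machine): $$p(h^{(L-1)},h^{(L)})\propto\exp\Big(\sum_{i,j}\theta_{ij}(h^{(L-1)}_i,h^{(L)}_j)+\sum_i a_i(h^{(L-1)}_i)+\sum_j b_j(h^{(L)}_j)\Big).$$ The interactions between all other pairs of subsequent layers are bipartite and directed towards the first layer: for $1\le l\le L-2$, $$p(h^{(l)}\mid h^{(l+1)})=\prod_{i=1}^n p(h^{(l)}_i\mid h^{(l+1)}),\qquad p(h^{(l)}_i\mid h^{(l+1)})\propto\exp\Big(\sum_j\theta^{(l)}_{ij}(h^{(l)}_i,h^{(l+1)}_j)+a^{(l)}_i(h^{(l)}_i)\Big).$$ Here all $\theta,a,b$ are arbitrary real-valued functions of the indicated states. The DBN model is the set of all marginal distributions on the visible layer, $$p(h^{(1)})=\sum_{h^{(2)},\dots,h^{(L)}}p(h^{(L-1)},h^{(L)})\prod_{l=1}^{L-2}p(h^{(l)}\mid h^{(l+1)}),$$ obtained for all choices of the real parameters. *)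

theory Defs
  imports "HOL-Probability.Probability"
begin

text \<open>
  Units within a layer are indexed by \<open>{1..n}\<close>; unit \<open>i\<close> of every layer takes values in the
  finite set \<open>X i\<close>. A joint state of a layer is an extensional function on \<open>{1..n}\<close>.
\<close>

definition states :: "nat \<Rightarrow> (nat \<Rightarrow> 'a set) \<Rightarrow> (nat \<Rightarrow> 'a) set" where
  "states n X = PiE {1..n} X"

definition rbm_weight :: "nat \<Rightarrow> (nat \<Rightarrow> nat \<Rightarrow> 'a \<Rightarrow> 'a \<Rightarrow> real) \<Rightarrow> (nat \<Rightarrow> 'a \<Rightarrow> real) \<Rightarrow>
    (nat \<Rightarrow> 'a \<Rightarrow> real) \<Rightarrow> (nat \<Rightarrow> 'a) \<Rightarrow> (nat \<Rightarrow> 'a) \<Rightarrow> real" where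
  "rbm_weight n \<theta> a c x y =
     exp ((\<Sum>i=1..n. \<Sum>j=1..n. \<theta> i j (x i) (y j)) + (\<Sum>i=1..n. a i (x i)) + (\<Sum>j=1..n. c j (y j)))"

definition rbm_prob :: "nat \<Rightarrow> (nat \<Rightarrow> 'a set) \<Rightarrow> (nat \<Rightarrow> nat \<Rightarrow> 'a \<Rightarrow> 'a \<Rightarrow> real) \<Rightarrow>
    (nat \<Rightarrow> 'a \<Rightarrow> real) \<Rightarrow> (nat \<Rightarrow> 'a \<Rightarrow> real) \<Rightarrow> (nat \<Rightarrow> 'a) \<Rightarrow> (nat \<Rightarrow> 'a) \<Rightarrow> real" where
  "rbm_prob n X \<theta> a c x y =
     rbm_weight n \<theta> a c x y /
       (\<Sum>x'\<in>states n X. \<Sum>y'\<in>states n X. rbm_weight n \<theta> a c x' y')"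

definition unit_weight :: "nat \<Rightarrow> (nat \<Rightarrow> nat \<Rightarrow> 'a \<Rightarrow> 'a \<Rightarrow> real) \<Rightarrow> (nat \<Rightarrow> 'a \<Rightarrow> real) \<Rightarrow>
    nat \<Rightarrow> 'a \<Rightarrow> (nat \<Rightarrow> 'a) \<Rightarrow> real" where
  "unit_weight n \<theta> a i s y = exp ((\<Sum>j=1..n. \<theta> i j s (y j)) + a i s)"

text \<open>The conditional probability of the state \<open>x\<close> of a layer given the state \<open>y\<close> of the next
  deeper layer.\<close>

definition layer_kernel :: "nat \<Rightarrow> (nat \<Rightarrow> 'a set) \<Rightarrow> (nat \<Rightarrow> nat \<Rightarrow> 'a \<Rightarrow> 'a \<Rightarrow> real) \<Rightarrow>
    (nat \<Rightarrow> 'a \<Rightarrow> real) \<Rightarrow> (nat \<Rightarrow> 'a) \<Rightarrow> (nat \<Rightarrow> 'a) \<Rightarrow> real" where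
  "layer_kernel n X \<theta> a x y =
     (\<Prod>i=1..n. unit_weight n \<theta> a i (x i) y / (\<Sum>s\<in>X i. unit_weight n \<theta> a i s y))"

text \<open>
  \<open>\<theta>, a, c\<close> parametrise the undirected interaction of layers \<open>L - 1\<close> and \<open>L\<close>, and
  \<open>\<theta>d l, ad l\<close> the interaction directed from layer \<open>l + 1\<close> to layer \<open>l\<close>.
  A configuration \<open>h\<close> assigns to each layer \<open>l \<in> {1..L}\<close> its state \<open>h l\<close>.
\<close>

definition dbn_joint :: "nat \<Rightarrow> (nat \<Rightarrow> 'a set) \<Rightarrow> nat \<Rightarrow>
    (nat \<Rightarrow> nat \<Rightarrow> 'a \<Rightarrow> 'a \<Rightarrow> real) \<Rightarrow> (nat \<Rightarrow> 'a \<Rightarrow> real) \<Rightarrow> (nat \<Rightarrow> 'a \<Rightarrow> real) \<Rightarrow>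
    (nat \<Rightarrow> nat \<Rightarrow> nat \<Rightarrow> 'a \<Rightarrow> 'a \<Rightarrow> real) \<Rightarrow> (nat \<Rightarrow> nat \<Rightarrow> 'a \<Rightarrow> real) \<Rightarrow>
    (nat \<Rightarrow> nat \<Rightarrow> 'a) \<Rightarrow> real" where
  "dbn_joint n X L \<theta> a c \<theta>d ad h =
     rbm_prob n X \<theta> a c (h (L - 1)) (h L) *
       (\<Prod>l=1..L-2. layer_kernel n X (\<theta>d l) (ad l) (h l) (h (l + 1)))"

definition dbn_marginal :: "nat \<Rightarrow> (nat \<Rightarrow> 'a set) \<Rightarrow> nat \<Rightarrow>
    (nat \<Rightarrow> nat \<Rightarrow> 'a \<Rightarrow> 'a \<Rightarrow> real) \<Rightarrow> (nat \<Rightarrow> 'a \<Rightarrow> real) \<Rightarrow> (nat \<Rightarrow> 'a \<Rightarrow> real) \<Rightarrow>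
    (nat \<Rightarrow> nat \<Rightarrow> nat \<Rightarrow> 'a \<Rightarrow> 'a \<Rightarrow> real) \<Rightarrow> (nat \<Rightarrow> nat \<Rightarrow> 'a \<Rightarrow> real) \<Rightarrow>
    (nat \<Rightarrow> 'a) \<Rightarrow> real" where
  "dbn_marginal n X L \<theta> a c \<theta>d ad v =
     (\<Sum>h\<in>{h \<in> PiE {1..L} (\<lambda>_. states n X). h 1 = v}. dbn_joint n X L \<theta> a c \<theta>d ad h)"

definition dbn_model :: "nat \<Rightarrow> (nat \<Rightarrow> 'a set) \<Rightarrow> nat \<Rightarrow> (nat \<Rightarrow> 'a) pmf set" where
  "dbn_model n X L =
     {p. set_pmf p \<subseteq> states n X \<and>
         (\<exists>\<theta> a c \<theta>d ad. \<forall>v\<in>states n X. pmf p v = dbn_marginal n X L \<theta> a c \<theta>d ad v)}"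

text \<open>
  Kullback--Leibler divergence, to base \<open>b\<close>, of distributions supported on the finite set \<open>A\<close>.
  The conventions \<open>0 log (0/y) = 0\<close> and \<open>x log (x/0) = \<infinity>\<close> for \<open>x > 0\<close> apply; the real-valued
  \<^const>\<open>KL_divergence\<close> does not provide the second one.
\<close>

definition kl_div :: "real \<Rightarrow> 's set \<Rightarrow> 's pmf \<Rightarrow> 's pmf \<Rightarrow> ereal" where
  "kl_div b A p q =
     (if set_pmf p \<subseteq> set_pmf q then ereal (\<Sum>x\<in>A. pmf p x * log b (pmf p x / pmf q x)) else \<infinity>)"

definition div_from_model :: "real \<Rightarrow> 's set \<Rightarrow> 's pmf \<Rightarrow> 's pmf set \<Rightarrow> ereal" where
  "div_from_model b A p M = (INF q\<in>M. kl_div b A p q)"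

text \<open>
  The supremum is a maximum whenever all members of \<open>M\<close> have support \<open>A\<close>, as those of the model
  above do: then \<open>p \<mapsto> D(p \<parallel> M)\<close> is upper semicontinuous on a compact simplex.
\<close>

definition max_divergence :: "real \<Rightarrow> 's set \<Rightarrow> 's pmf set \<Rightarrow> ereal" where
  "max_divergence b A M = (SUP p\<in>{p. set_pmf p \<subseteq> A}. div_from_model b A p M)"


text \<open>
  For every choice of the parameters the marginals \<^const>\<open>dbn_marginal\<close> are strictly positive
  and sum to one, so each choice gives exactly one member of \<^const>\<open>dbn_model\<close>.
\<close>

lemma rbm_weight_pos: "rbm_weight n \<theta> a c x y > 0"
  by (simp add: rbm_weight_def)

lemma unit_weight_pos: "unit_weight n \<theta> a i s y > 0"
  by (simp add: unit_weight_def)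

context
  fixes n :: nat and X :: "nat \<Rightarrow> 'a set"
  assumes X: "\<And>i. i \<in> {1..n} \<Longrightarrow> finite (X i) \<and> X i \<noteq> {}"
begin

lemma finite_states: "finite (states n X)"
  using X by (auto simp: states_def intro!: finite_PiE)

lemma states_nonempty: "states n X \<noteq> {}"
  using X by (auto simp: states_def PiE_eq_empty_iff)

lemma rbm_norm_pos: "(\<Sum>x\<in>states n X. \<Sum>y\<in>states n X. rbm_weight n \<theta> a c x y) > 0"
  by (intro sum_pos finite_states states_nonempty rbm_weight_pos)

lemma rbm_prob_pos: "rbm_prob n X \<theta> a c x y > 0"
  unfolding rbm_prob_def using rbm_norm_pos rbm_weight_pos by (rule divide_pos_pos[rotated])

lemma rbm_prob_sum: "(\<Sum>x\<in>states n X. \<Sum>y\<in>states n X. rbm_prob n X \<theta> a c x y) = 1"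
  using rbm_norm_pos[of \<theta> a c] by (simp add: rbm_prob_def flip: sum_divide_distrib)

lemma unit_norm_pos: "i \<in> {1..n} \<Longrightarrow> (\<Sum>s\<in>X i. unit_weight n \<theta> a i s y) > 0"
  using X by (intro sum_pos unit_weight_pos) auto

lemma layer_kernel_pos: "layer_kernel n X \<theta> a x y > 0"
  unfolding layer_kernel_def
  by (intro prod_pos ballI divide_pos_pos unit_weight_pos unit_norm_pos)

lemma layer_kernel_sum: "(\<Sum>x\<in>states n X. layer_kernel n X \<theta> a x y) = 1"
proof -
  have "(\<Sum>x\<in>states n X. layer_kernel n X \<theta> a x y) =
      (\<Prod>i=1..n. \<Sum>t\<in>X i. unit_weight n \<theta> a i t y / (\<Sum>s\<in>X i. unit_weight n \<theta> a i s y))"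
    unfolding layer_kernel_def states_def using X
    by (intro prod_sum_PiE[symmetric]) auto
  also have "\<dots> = 1"
    using unit_norm_pos[of _ \<theta> a y]
    by (intro prod.neutral) (force simp flip: sum_divide_distrib)
  finally show ?thesis .
qed

lemma sum_PiE_insert:
  fixes f :: "('i \<Rightarrow> 'b) \<Rightarrow> real"
  assumes "k \<notin> I"
  shows "(\<Sum>h\<in>PiE (insert k I) (\<lambda>_. A). f h) = (\<Sum>g\<in>PiE I (\<lambda>_. A). \<Sum>x\<in>A. f (g(k := x)))"
proof -
  have "(\<Sum>h\<in>PiE (insert k I) (\<lambda>_. A). f h) =
      (\<Sum>(x, g)\<in>A \<times> PiE I (\<lambda>_. A). f (g(k := x)))"
    unfolding PiE_insert_eq using inj_combinator[OF assms, of "\<lambda>_. A"]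
    by (subst sum.reindex) (auto simp: case_prod_unfold)
  then show ?thesis
    by (simp add: sum.cartesian_product[symmetric] sum.swap[of _ A])
qed

lemma dbn_tail_sum:
  fixes k L :: nat
  assumes "k \<le> L - 1" "L \<ge> 2"
  shows "(\<Sum>h\<in>PiE {k..L} (\<lambda>_. states n X). rbm_prob n X \<theta> a c (h (L - 1)) (h L) *
       (\<Prod>l=k..L-2. layer_kernel n X (\<theta>d l) (ad l) (h l) (h (l + 1)))) = 1"
  using assms(1)
proof (induction rule: inc_induct)
  case base
  have eq: "{L - 1..L} = insert (L - 1) (insert L {})" "{L - 1..L - 2} = {}" "L - 1 \<noteq> L"
    using assms(2) by auto
  have "(\<Sum>h\<in>PiE {L - 1..L} (\<lambda>_. states n X). rbm_prob n X \<theta> a c (h (L - 1)) (h L)) =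
      (\<Sum>y\<in>states n X. \<Sum>x\<in>states n X. rbm_prob n X \<theta> a c x y)"
    unfolding eq(1) using eq(3) by (simp add: sum_PiE_insert del: PiE_insert_eq)
  also have "\<dots> = 1"
    by (subst sum.swap) (rule rbm_prob_sum)
  finally show ?case
    unfolding eq(2) by simp
next
  case (step k)
  have eq: "{k..L} = insert k {Suc k..L}" "{k..L-2} = insert k {Suc k..L-2}"
    using step assms(2) by auto
  let ?r = "\<lambda>h. rbm_prob n X \<theta> a c (h (L - 1)) (h L)"
  let ?f = "\<lambda>l h. layer_kernel n X (\<theta>d l) (ad l) (h l) (h (l + 1))"
  have split: "?r (g(k := x)) * (\<Prod>l=k..L-2. ?f l (g(k := x))) =
      (?r g * (\<Prod>l=Suc k..L-2. ?f l g)) * layer_kernel n X (\<theta>d k) (ad k) x (g (Suc k))" for g x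
  proof -
    have "?r (g(k := x)) = ?r g"
      using step assms(2) by auto
    moreover have "(\<Prod>l=Suc k..L-2. ?f l (g(k := x))) = (\<Prod>l=Suc k..L-2. ?f l g)"
      by (intro prod.cong) auto
    moreover have "(\<Prod>l=k..L-2. ?f l (g(k := x))) =
        ?f k (g(k := x)) * (\<Prod>l=Suc k..L-2. ?f l (g(k := x)))"
      unfolding eq(2) by (rule prod.insert) auto
    ultimately show ?thesis by simp
  qed
  have "(\<Sum>h\<in>PiE {k..L} (\<lambda>_. states n X). ?r h * (\<Prod>l=k..L-2. ?f l h)) =
      (\<Sum>g\<in>PiE {Suc k..L} (\<lambda>_. states n X). \<Sum>x\<in>states n X.
        ?r (g(k := x)) * (\<Prod>l=k..L-2. ?f l (g(k := x))))"
    unfolding eq(1) by (rule sum_PiE_insert) auto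
  also have "\<dots> = (\<Sum>g\<in>PiE {Suc k..L} (\<lambda>_. states n X). ?r g * (\<Prod>l=Suc k..L-2. ?f l g))"
    by (simp only: split layer_kernel_sum mult_1_right flip: sum_distrib_left)
  also have "\<dots> = 1" by (rule step.IH)
  finally show ?case .
qed

lemma dbn_marginal_sum:
  assumes "L \<ge> 2"
  shows "(\<Sum>v\<in>states n X. dbn_marginal n X L \<theta> a c \<theta>d ad v) = 1"
proof -
  have fin: "finite (PiE {1..L} (\<lambda>_. states n X))"
    by (intro finite_PiE finite_states) auto
  have "(\<Sum>v\<in>states n X. dbn_marginal n X L \<theta> a c \<theta>d ad v) =
      (\<Sum>h\<in>PiE {1..L} (\<lambda>_. states n X). dbn_joint n X L \<theta> a c \<theta>d ad h)"
    unfolding dbn_marginal_def using assms fin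
    by (intro sum.group finite_states) (auto simp: PiE_iff)
  also have "\<dots> = 1"
    unfolding dbn_joint_def using assms by (intro dbn_tail_sum) auto
  finally show ?thesis .
qed

lemma dbn_marginal_pos:
  assumes "L \<ge> 2" "v \<in> states n X"
  shows "dbn_marginal n X L \<theta> a c \<theta>d ad v > 0"
proof -
  have "(\<lambda>l\<in>{1..L}. v) \<in> {h \<in> PiE {1..L} (\<lambda>_. states n X). h 1 = v}"
    using assms by auto
  moreover have "finite {h \<in> PiE {1..L} (\<lambda>_. states n X). h 1 = v}"
    by (intro finite_subset[OF _ finite_PiE[of "{1..L}" "\<lambda>_. states n X"]]) (auto intro: finite_states)
  ultimately show ?thesis
    unfolding dbn_marginal_def dbn_joint_def
    by (intro sum_pos mult_pos_pos rbm_prob_pos prod_pos ballI layer_kernel_pos) blast+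
qed

lemma dbn_model_ex1:
  assumes "L \<ge> 2"
  shows "\<exists>!p. p \<in> dbn_model n X L \<and> (\<forall>v\<in>states n X. pmf p v = dbn_marginal n X L \<theta> a c \<theta>d ad v)"
proof (rule ex_ex1I)
  let ?g = "\<lambda>v. if v \<in> states n X then dbn_marginal n X L \<theta> a c \<theta>d ad v else 0"
  have nonneg: "?g v \<ge> 0" for v
    using dbn_marginal_pos[OF assms] by (simp add: less_imp_le)
  have "(\<integral>\<^sup>+ v. ennreal (?g v) \<partial>count_space UNIV) = (\<Sum>v\<in>states n X. ennreal (?g v))"
    by (intro nn_integral_count_space'[OF finite_states]) auto
  also have "\<dots> = ennreal (\<Sum>v\<in>states n X. ?g v)"
    using nonneg by (intro sum_ennreal)
  also have "\<dots> = 1"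
    using dbn_marginal_sum[OF assms] by simp
  finally have one: "(\<integral>\<^sup>+ v. ennreal (?g v) \<partial>count_space UNIV) = 1" .
  have "pmf (embed_pmf ?g) v = ?g v" for v
    by (rule pmf_embed_pmf[OF nonneg one])
  moreover have "set_pmf (embed_pmf ?g) = {v. ?g v \<noteq> 0}"
    by (rule set_embed_pmf[OF nonneg one])
  ultimately show "\<exists>p. p \<in> dbn_model n X L \<and>
      (\<forall>v\<in>states n X. pmf p v = dbn_marginal n X L \<theta> a c \<theta>d ad v)"
    unfolding dbn_model_def
    by (intro exI[of _ "embed_pmf ?g"] conjI CollectI exI[of _ \<theta>] exI[of _ a] exI[of _ c]
        exI[of _ \<theta>d] exI[of _ ad]) auto
next
  fix p p'
  assume "p \<in> dbn_model n X L \<and> (\<forall>v\<in>states n X. pmf p v = dbn_marginal n X L \<theta> a c \<theta>d ad v)"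
    and "p' \<in> dbn_model n X L \<and> (\<forall>v\<in>states n X. pmf p' v = dbn_marginal n X L \<theta> a c \<theta>d ad v)"
  then have "set_pmf p \<subseteq> states n X" "set_pmf p' \<subseteq> states n X"
    and "\<forall>v\<in>states n X. pmf p v = pmf p' v"
    by (simp_all add: dbn_model_def)
  then have "pmf p v = pmf p' v" for v
    by (metis pmf_eq_0_set_pmf subsetD)
  then show "p = p'" by (rule pmf_eqI)
qed

end

end

(* Let all parameters grow along a ray K * A + F with K -> infinity: Gibbs weights then concentrate on
   the maximisers of A and keep the finite weights exp F among them. In this limit the deepest pair of
   layers produces a mixture over the blocks, the values r of the coordinates m + 2, ..., n, and a
   directed layer either copies a unit or, on a single face of the state space, redistributes its state
   arbitrarily (probability sharing). A block expands S of the coordinates 1, ..., m one after another,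
   a prefix word of length s costing one layer for each of its at most q_1^s values; the blocks use
   cyclic shifts of the coordinates, so that at each time every unit serves at most one block. The
   remaining m - S coordinates stay uniform. The resulting q satisfies p <= (C + epsilon) q pointwise,
   with C the largest number of values of m - S coordinates, and hence D(p || q) <= log (C + epsilon). *)

theory Submission
  imports Defs
begin

section \<open>Softmax limits, bijective numeration, products over index sets\<close>

text \<open>Divide by \<open>exp (K * A z0)\<close>: a non-maximiser then has a negative coefficient
  at \<open>K\<close> and dies out, while each maximiser keeps its finite weight.\<close>

lemma softmax_tendsto:
  fixes A F :: "'z \<Rightarrow> real"
  assumes "finite Z" "z0 \<in> Z" and max: "\<And>z. z \<in> Z \<Longrightarrow> A z \<le> A z0"
  shows "((\<lambda>K. exp (K * A z0 + F z0) / (\<Sum>z\<in>Z. exp (K * A z + F z)))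
    \<longlongrightarrow> exp (F z0) / (\<Sum>z\<in>{z \<in> Z. A z = A z0}. exp (F z))) at_top"
proof -
  have lim: "((\<lambda>K. exp (K * (A z - A z0) + F z)) \<longlongrightarrow> (if A z = A z0 then exp (F z) else 0)) at_top"
    if "z \<in> Z" for z
  proof (cases "A z = A z0")
    case True
    then show ?thesis by simp
  next
    case False
    with max[OF that] have "A z - A z0 < 0" by simp
    then have "filterlim (\<lambda>K. K * (A z - A z0)) at_bot at_top"
      using filterlim_tendsto_neg_mult_at_bot[OF tendsto_const _ filterlim_ident, of "A z - A z0"]
      by (simp add: mult.commute)
    then have "((\<lambda>K. exp (K * (A z - A z0))) \<longlongrightarrow> 0) at_top"
      by (rule filterlim_compose[OF exp_at_bot])
    from tendsto_mult_left_zero[OF this, of "exp (F z)"] False show ?thesis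
      by (simp add: exp_add)
  qed
  have sum: "(\<Sum>z\<in>{z \<in> Z. A z = A z0}. exp (F z)) = (\<Sum>z\<in>Z. if A z = A z0 then exp (F z) else 0)"
    using assms(1) by (rule sum.inter_filter)
  have pos: "(\<Sum>z\<in>{z \<in> Z. A z = A z0}. exp (F z)) > 0"
    using assms by (intro sum_pos) auto
  have "((\<lambda>K. exp (F z0) / (\<Sum>z\<in>Z. exp (K * (A z - A z0) + F z)))
    \<longlongrightarrow> exp (F z0) / (\<Sum>z\<in>{z \<in> Z. A z = A z0}. exp (F z))) at_top"
    using pos unfolding sum by (intro tendsto_divide tendsto_const tendsto_sum lim) auto
  moreover have "exp (F z0) / (\<Sum>z\<in>Z. exp (K * (A z - A z0) + F z)) =
      exp (K * A z0 + F z0) / (\<Sum>z\<in>Z. exp (K * A z + F z))" for K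
  proof -
    have "(\<Sum>z\<in>Z. exp (K * A z + F z)) = exp (K * A z0) * (\<Sum>z\<in>Z. exp (K * (A z - A z0) + F z))"
      unfolding sum_distrib_left by (intro sum.cong) (auto simp: algebra_simps simp flip: exp_add)
    then show ?thesis by (simp add: exp_add)
  qed
  ultimately show ?thesis by simp
qed

text \<open>The digits \<open>1 + d t\<close> run through 1, ..., \<open>Q\<close>. As 0 is no
  digit, even the length is determined: the residue modulo \<open>Q\<close> yields the lowest digit,
  the quotient the others.\<close>

lemma bijective_numeration_unique:
  fixes d d' :: "nat \<Rightarrow> nat"
  assumes "(\<Sum>t<s. (1 + d t) * Q ^ t) = (\<Sum>t<s'. (1 + d' t) * Q ^ t)"
    and "\<And>t. t < s \<Longrightarrow> d t < Q" "\<And>t. t < s' \<Longrightarrow> d' t < Q"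
  shows "s = s' \<and> (\<forall>t<s. d t = d' t)"
  using assms
proof (induction s arbitrary: s' d d')
  case 0
  then show ?case by (cases s') (auto simp: sum.lessThan_Suc_shift simp del: sum.lessThan_Suc)
next
  case (Suc s)
  show ?case
  proof (cases s')
    case 0
    with Suc.prems(1) show ?thesis by (auto simp: sum.lessThan_Suc_shift simp del: sum.lessThan_Suc)
  next
    case s': (Suc s1)
    define R where "R = (\<Sum>t<s. (1 + d (Suc t)) * Q ^ t)"
    define R' where "R' = (\<Sum>t<s1. (1 + d' (Suc t)) * Q ^ t)"
    have less: "d 0 < Q" "d' 0 < Q" using Suc.prems s' by auto
    have eq: "d 0 + Q * R = d' 0 + Q * R'"
      using Suc.prems(1) unfolding s' R_def R'_def sum.lessThan_Suc_shift
      by (simp add: sum_distrib_left algebra_simps del: sum.lessThan_Suc)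
    from arg_cong[OF eq, of "\<lambda>u. u mod Q"] less have d0: "d 0 = d' 0" by simp
    with eq less have "R = R'" by simp
    then have "s = s1 \<and> (\<forall>t<s. d (Suc t) = d' (Suc t))"
      unfolding R_def R'_def using Suc.prems s' by (intro Suc.IH) auto
    with d0 s' show ?thesis by (auto simp: less_Suc_eq_0_disj)
  qed
qed

text \<open>Remove the largest index of \<open>B\<close>: it is at least \<open>card B\<close>, so
  its factor is at most \<open>q (card B)\<close>.\<close>

lemma prod_le_prod_initial:
  fixes q :: "nat \<Rightarrow> nat"
  assumes "B \<subseteq> {1..m}" "card B = k"
    and "\<And>i j. 1 \<le> i \<Longrightarrow> i \<le> j \<Longrightarrow> j \<le> m \<Longrightarrow> q j \<le> q i"
  shows "(\<Prod>i\<in>B. q i) \<le> (\<Prod>i=1..k. q i)"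
  using assms(1,2)
proof (induction k arbitrary: B)
  case 0
  then have "B = {}" by (meson card_0_eq finite_atLeastAtMost finite_subset)
  then show ?case by simp
next
  case (Suc k)
  have fin: "finite B" using Suc.prems(1) finite_subset by blast
  have ne: "B \<noteq> {}" using Suc.prems(2) by auto
  define M where "M = Max B"
  have M: "M \<in> B" unfolding M_def using fin ne by simp
  have "B \<subseteq> {1..M}" using Suc.prems(1) fin by (auto simp: M_def)
  then have "Suc k \<le> M" using card_mono[of "{1..M}" B] Suc.prems(2) by simp
  then have "q M \<le> q (Suc k)" using assms(3)[of "Suc k" M] M Suc.prems(1) by auto
  moreover have "(\<Prod>i\<in>B - {M}. q i) \<le> (\<Prod>i=1..k. q i)"
    using Suc.prems fin M by (intro Suc.IH) auto
  ultimately have "q M * (\<Prod>i\<in>B - {M}. q i) \<le> q (Suc k) * (\<Prod>i=1..k. q i)"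
    by (rule mult_le_mono)
  then show ?case using prod.remove[OF fin M, of q] by (simp add: mult.commute)
qed

section \<open>Probability sharing\<close>

text \<open>
  Unit \<open>i\<close> rests in \<open>base i\<close>; \<open>alt i\<close> is a second state, \<open>dig i\<close> numbers its states by digits below
  \<open>Q\<close>, and \<open>bl x\<close> is the block of \<open>x\<close>, the value of its coordinates \<open>m + 2, \<dots>, n\<close>, encoded as the
  index of a unit.
\<close>

locale sharing =
  fixes n m S Q :: nat and X :: "nat \<Rightarrow> 'a set" and P :: "(nat \<Rightarrow> 'a) \<Rightarrow> real"
    and base alt :: "nat \<Rightarrow> 'a" and dig :: "nat \<Rightarrow> 'a \<Rightarrow> nat" and bl :: "(nat \<Rightarrow> 'a) \<Rightarrow> nat"
  assumes fin: "i \<in> {1..n} \<Longrightarrow> finite (X i)"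
    and base: "i \<in> {1..n} \<Longrightarrow> base i \<in> X i"
    and alt: "i \<in> {1..n} \<Longrightarrow> alt i \<in> X i" "i \<in> {1..n} \<Longrightarrow> alt i \<noteq> base i"
    and dig_inj: "i \<in> {1..m} \<Longrightarrow> inj_on (dig i) (X i)"
    and dig_less: "i \<in> {1..m} \<Longrightarrow> a \<in> X i \<Longrightarrow> dig i a < Q"
    and bl: "x \<in> states n X \<Longrightarrow> bl x \<in> {1..m}"
    and bl_eq_iff: "x \<in> states n X \<Longrightarrow> y \<in> states n X \<Longrightarrow>
      bl x = bl y \<longleftrightarrow> (\<forall>i\<in>{m+2..n}. x i = y i)"
    and m_le: "m \<le> n" and S_le: "S \<le> m"
    and P_pos: "x \<in> states n X \<Longrightarrow> P x > 0"
    and P_sum: "(\<Sum>x\<in>states n X. P x) = 1"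
begin

lemma X_fin_ne: "i \<in> {1..n} \<Longrightarrow> finite (X i) \<and> X i \<noteq> {}"
  using fin base by blast

lemma fin_states: "finite (states n X)"
  by (rule finite_states[OF X_fin_ne])

lemma states_mem: "x \<in> states n X \<Longrightarrow> i \<in> {1..n} \<Longrightarrow> x i \<in> X i"
  by (auto simp: states_def)

lemma states_upd: "x \<in> states n X \<Longrightarrow> i \<in> {1..n} \<Longrightarrow> a \<in> X i \<Longrightarrow> x(i := a) \<in> states n X"
  by (auto simp: states_def PiE_iff extensional_def)

lemma states_undefined: "x \<in> states n X \<Longrightarrow> i \<notin> {1..n} \<Longrightarrow> x i = undefined"
  by (auto simp: states_def PiE_iff extensional_def)

section \<open>Cyclic orders of the coordinates\<close>

text \<open>Position \<open>s\<close> in the order used by block \<open>r\<close>. For fixed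
  \<open>s\<close> it is injective in \<open>r\<close>, so blocks that have expanded equally many
  coordinates work on different units.\<close>

definition crd :: "nat \<Rightarrow> nat \<Rightarrow> nat" where
  "crd r s = (r + s) mod m + 1"

text \<open>The \<open>S\<close> coordinates that block \<open>r\<close> expands.\<close>

definition A :: "nat \<Rightarrow> nat set" where
  "A r = crd r ` {..<S}"

lemma m_pos: "m > 0"
proof -
  have "(\<lambda>i\<in>{1..n}. base i) \<in> states n X"
    using base by (auto simp: states_def)
  then have "bl (\<lambda>i\<in>{1..n}. base i) \<in> {1..m}" by (rule bl)
  then show ?thesis by simp
qed

lemma crd: "crd r s \<in> {1..m}"
  using m_pos by (simp add: crd_def Suc_le_eq)

lemma crd_n: "crd r s \<in> {1..n}"
  using crd[of r s] m_le by auto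

lemma mod_add_left_cancel:
  assumes "(r + s) mod m = (r + s') mod m" "s < m" "s' < m"
  shows "s = s'"
proof -
  have le: "a = b" if "(r + a) mod m = (r + b) mod m" "a \<le> b" "b < m" for a b
  proof -
    have "m dvd (r + b) - (r + a)"
      using that by (subst mod_eq_dvd_iff_nat[symmetric]) auto
    then have "m dvd b - a" by simp
    from dvd_imp_le[OF this] that show "a = b" by linarith
  qed
  show ?thesis using le[of s s'] le[of s' s] assms by (cases "s \<le> s'") auto
qed

lemma crd_inj_right: "crd r s = crd r s' \<Longrightarrow> s < S \<Longrightarrow> s' < S \<Longrightarrow> s = s'"
  using S_le by (intro mod_add_left_cancel[of r s s']) (auto simp: crd_def)

lemma crd_inj_left:
  assumes "crd r s = crd r' s" "r \<in> {1..m}" "r' \<in> {1..m}"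
  shows "r = r'"
proof -
  have "((s + 1) + (r - 1)) mod m = ((s + 1) + (r' - 1)) mod m"
    using assms by (simp add: crd_def add.commute[of s])
  then have "r - 1 = r' - 1"
    using assms(2,3) by (intro mod_add_left_cancel[of "s + 1" "r - 1" "r' - 1"]) auto
  with assms(2,3) show ?thesis by auto
qed

lemma A_subset: "A r \<subseteq> {1..m}"
  using crd by (auto simp: A_def)

lemma card_A: "card (A r) = S"
  unfolding A_def using crd_inj_right by (subst card_image) (auto simp: inj_on_def)

section \<open>Marginals of the target distribution\<close>

definition cyl :: "nat set \<Rightarrow> (nat \<Rightarrow> 'a) \<Rightarrow> (nat \<Rightarrow> 'a) set" where
  "cyl D x = {x' \<in> states n X. \<forall>i\<in>D. x' i = x i}"

text \<open>The marginal of \<open>P\<close> on the coordinates in \<open>D\<close>; quotients of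
  such marginals are the conditional probabilities that the expansion steps realise.\<close>

definition W :: "nat set \<Rightarrow> (nat \<Rightarrow> 'a) \<Rightarrow> real" where
  "W D x = (\<Sum>x'\<in>cyl D x. P x')"

lemma fin_cyl: "finite (cyl D x)"
  using fin_states by (simp add: cyl_def)

lemma W_ge: "x \<in> states n X \<Longrightarrow> P x \<le> W D x"
  unfolding W_def using fin_cyl P_pos
  by (intro member_le_sum) (auto simp: cyl_def less_imp_le)

lemma W_pos: "x \<in> states n X \<Longrightarrow> W D x > 0"
  using W_ge P_pos by (meson less_le_trans)

lemma W_cong: "(\<And>i. i \<in> D \<Longrightarrow> x i = y i) \<Longrightarrow> W D x = W D y"
  unfolding W_def cyl_def by (intro sum.cong) auto

lemma W_refine:
  assumes "x \<in> states n X" "i \<in> {1..n}" "i \<notin> D"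
  shows "(\<Sum>a\<in>X i. W (insert i D) (x(i := a))) = W D x"
proof -
  have "cyl (insert i D) (x(i := a)) = {x' \<in> cyl D x. x' i = a}" for a
    using assms(3) by (auto simp: cyl_def)
  then have "(\<Sum>a\<in>X i. W (insert i D) (x(i := a))) = (\<Sum>a\<in>X i. \<Sum>x'\<in>{x' \<in> cyl D x. x' i = a}. P x')"
    unfolding W_def by (simp only:)
  also have "\<dots> = W D x"
    unfolding W_def using fin_cyl fin[OF assms(2)] states_mem[OF _ assms(2)]
    by (intro sum.group) (auto simp: cyl_def)
  finally show ?thesis .
qed

lemma card_cyl:
  assumes "x \<in> states n X" "D \<subseteq> {1..n}"
  shows "card (cyl D x) = (\<Prod>i\<in>{1..n} - D. card (X i))"
proof -
  have "cyl D x = PiE {1..n} (\<lambda>i. if i \<in> D then {x i} else X i)"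
  proof (intro set_eqI iffI)
    fix y
    assume y: "y \<in> PiE {1..n} (\<lambda>i. if i \<in> D then {x i} else X i)"
    have mem: "y i \<in> (if i \<in> D then {x i} else X i)" if "i \<in> {1..n}" for i
      using PiE_mem[OF y that] .
    have "y \<in> states n X"
      unfolding states_def
    proof (rule PiE_I)
      show "y i \<in> X i" if "i \<in> {1..n}" for i
        using mem[OF that] states_mem[OF assms(1) that] by (cases "i \<in> D") auto
    qed (rule PiE_arb[OF y])
    moreover have "\<forall>i\<in>D. y i = x i"
      using mem assms(2) by fastforce
    ultimately show "y \<in> cyl D x" by (simp add: cyl_def)
  qed (auto simp: cyl_def states_def PiE_iff)
  then have "card (cyl D x) = (\<Prod>i\<in>{1..n}. card (if i \<in> D then {x i} else X i))"
    by (simp add: card_PiE)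
  also have "\<dots> = (\<Prod>i\<in>{1..n} - D. card (X i))"
    by (rule prod.mono_neutral_cong_right) auto
  finally show ?thesis .
qed

text \<open>Counts the settings of the coordinates up to \<open>m\<close> that block
  \<open>r\<close> leaves uniform; this is the factor lost against the target.\<close>

definition N :: "nat \<Rightarrow> nat" where
  "N r = (\<Prod>i\<in>{1..m} - A r. card (X i))"

lemma N_pos: "N r > 0"
proof -
  have "card (X i) > 0" if "i \<in> {1..m}" for i
    using X_fin_ne[of i] that m_le by (simp add: card_gt_0_iff)
  then show ?thesis unfolding N_def by (intro prod_pos) auto
qed

section \<open>Expansion times and the path towards a state\<close>

text \<open>The time at which a state starts to have coordinate \<open>crd (bl x) s\<close> expanded: words of length
  less than \<open>s\<close> come first, and words of length \<open>s\<close> are ordered by bijective base-\<open>Q\<close> numeration.\<close>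

definition tm :: "nat \<Rightarrow> (nat \<Rightarrow> 'a) \<Rightarrow> nat" where
  "tm s x = (\<Sum>t<s. (1 + dig (crd (bl x) t) (x (crd (bl x) t))) * Q ^ t)"

lemma dig_state: "x \<in> states n X \<Longrightarrow> dig (crd r t) (x (crd r t)) < Q"
  by (rule dig_less[OF crd states_mem[OF _ crd_n]])

lemma Q_pos: "Q > 0"
proof -
  have "dig 1 (base 1) < Q"
    using m_pos m_le by (intro dig_less base) auto
  then show ?thesis by simp
qed

text \<open>With the largest digit \<open>Q\<close> at every place the time is
  \<open>Q + ... + Q ^ s\<close>, one below the bound, which counts the words of length at most
  \<open>s\<close>.\<close>

lemma tm_less:
  assumes "x \<in> states n X"
  shows "tm s x < (\<Sum>t<Suc s. Q ^ t)"
proof (induction s)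
  case 0
  then show ?case by (simp add: tm_def)
next
  case (Suc s)
  have "(1 + dig (crd (bl x) s) (x (crd (bl x) s))) * Q ^ s \<le> Q * Q ^ s"
    using dig_state[OF assms, of "bl x" s] by (intro mult_right_mono) auto
  moreover have "tm (Suc s) x = tm s x + (1 + dig (crd (bl x) s) (x (crd (bl x) s))) * Q ^ s"
    by (simp add: tm_def)
  moreover have "(\<Sum>t<Suc (Suc s). Q ^ t) = (\<Sum>t<Suc s. Q ^ t) + Q * Q ^ s"
    by simp
  ultimately show ?case using Suc by linarith
qed

lemma tm_strict_mono: "s < s' \<Longrightarrow> tm s x < tm s' x"
  by (erule lift_Suc_mono_less[rotated]) (simp add: tm_def Q_pos)

lemma tm_mono: "s \<le> s' \<Longrightarrow> tm s x \<le> tm s' x"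
  using tm_strict_mono[of s s' x] by (cases "s = s'") auto

lemma tm_cong: "bl x = bl y \<Longrightarrow> (\<And>t. t < s \<Longrightarrow> x (crd (bl y) t) = y (crd (bl y) t)) \<Longrightarrow> tm s x = tm s y"
  by (simp add: tm_def)

text \<open>Equal times give equal lengths and digits by the numeration. The cyclic shift then
  recovers the block from the unit, and only with the block known can digits be decoded into
  states.\<close>

lemma tm_unique:
  assumes "tm s x = tm s' y" "x \<in> states n X" "y \<in> states n X"
    and "crd (bl x) s = crd (bl y) s'"
  shows "s = s' \<and> bl x = bl y \<and> (\<forall>t<s. x (crd (bl y) t) = y (crd (bl y) t))"
proof -
  have *: "s = s' \<and> (\<forall>t<s. dig (crd (bl x) t) (x (crd (bl x) t)) = dig (crd (bl y) t) (y (crd (bl y) t)))"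
    using assms(1) unfolding tm_def
    by (rule bijective_numeration_unique) (use assms dig_state in auto)
  then have r: "bl x = bl y"
    using crd_inj_left[of "bl x" s "bl y"] assms(4) bl[OF assms(2)] bl[OF assms(3)] by simp
  have "x (crd (bl y) t) = y (crd (bl y) t)" if "t < s" for t
    by (rule inj_onD[OF dig_inj[OF crd] _ states_mem[OF assms(2) crd_n] states_mem[OF assms(3) crd_n]])
      (use * that r in auto)
  with * r show ?thesis by blast
qed

text \<open>The state on the way to \<open>v\<close> after the steps 0, ...,
  \<open>\<tau> - 1\<close>: a coordinate leaves its base state in the step numbered by its
  time.\<close>

definition stage :: "nat \<Rightarrow> (nat \<Rightarrow> 'a) \<Rightarrow> nat \<Rightarrow> 'a" where
  "stage \<tau> v i = (if \<exists>s<S. i = crd (bl v) s \<and> \<tau> \<le> tm s v then base i else v i)"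

lemma stage_states: "v \<in> states n X \<Longrightarrow> stage \<tau> v \<in> states n X"
  using base crd_n unfolding stage_def states_def by (auto simp: PiE_iff extensional_def)

lemma stage_outside: "i \<notin> {1..m} \<Longrightarrow> stage \<tau> v i = v i"
  using crd by (auto simp: stage_def)

lemma bl_stage: "v \<in> states n X \<Longrightarrow> bl (stage \<tau> v) = bl v"
  using stage_outside by (subst bl_eq_iff) (auto simp: stage_states)

lemma stage_crd:
  assumes "s < S"
  shows "stage \<tau> v (crd (bl v) s) = (if \<tau> \<le> tm s v then base (crd (bl v) s) else v (crd (bl v) s))"
  using assms by (auto simp: stage_def dest: crd_inj_right)

lemma stage_final:
  assumes "v \<in> states n X" "(\<Sum>t<S. Q ^ t) \<le> T"
  shows "stage T v = v"
proof -
  have "tm s v < T" if "s < S" for s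
  proof -
    have "tm s v < (\<Sum>t<Suc s. Q ^ t)" by (rule tm_less[OF assms(1)])
    also have "\<dots> \<le> (\<Sum>t<S. Q ^ t)" using that by (intro sum_mono2) auto
    finally show ?thesis using assms(2) by simp
  qed
  then show ?thesis by (intro ext) (auto simp: stage_def not_le[symmetric])
qed

text \<open>\<open>expd \<tau> i s z\<close>: unit \<open>i\<close> spreads the mass of \<open>z\<close> along coordinate \<open>i\<close> in step \<open>\<tau>\<close>, where \<open>i\<close>
  is the coordinate number \<open>s\<close> of the block of \<open>z\<close>. For fixed \<open>\<tau>\<close> and \<open>i\<close> the set of these \<open>z\<close> is
  empty or a face of the state space, which is what makes the exception realisable by one unit.\<close>

definition expd :: "nat \<Rightarrow> nat \<Rightarrow> nat \<Rightarrow> (nat \<Rightarrow> 'a) \<Rightarrow> bool" where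
  "expd \<tau> i s z \<longleftrightarrow> z \<in> states n X \<and> s < S \<and> crd (bl z) s = i \<and> tm s z = \<tau> \<and>
    (\<forall>t. s \<le> t \<longrightarrow> t < S \<longrightarrow> z (crd (bl z) t) = base (crd (bl z) t))"

text \<open>The fixed coordinates of the face; free are \<open>m + 1\<close> and the coordinates up
  to \<open>m\<close> that the block never expands.\<close>

definition face :: "(nat \<Rightarrow> 'a) \<Rightarrow> nat set" where
  "face z = {m+2..n} \<union> A (bl z)"

text \<open>By \<open>tm_unique\<close>, states expanded by one unit in one step share block and
  prefix word, and the later coordinates are at base. Conversely, \<open>expd\<close> reads face
  coordinates only.\<close>

lemma expd_face_iff:
  assumes "expd \<tau> i s z" "y \<in> states n X"
  shows "(\<exists>s'. expd \<tau> i s' y) \<longleftrightarrow> (\<forall>j\<in>face z. y j = z j)"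
proof
  assume "\<exists>s'. expd \<tau> i s' y"
  then obtain s' where y: "expd \<tau> i s' y" by blast
  have "s' = s \<and> bl y = bl z \<and> (\<forall>t<s'. y (crd (bl z) t) = z (crd (bl z) t))"
    using y assms(1) by (intro tm_unique) (auto simp: expd_def)
  moreover then have "y (crd (bl z) t) = z (crd (bl z) t)" if "t < S" for t
    using y assms(1) that by (cases "t < s") (auto simp: expd_def)
  moreover have "\<forall>j\<in>{m+2..n}. y j = z j"
    using calculation(1) bl_eq_iff[OF assms(2), of z] assms(1) by (auto simp: expd_def)
  ultimately show "\<forall>j\<in>face z. y j = z j" by (auto simp: face_def A_def)
next
  assume agree: "\<forall>j\<in>face z. y j = z j"
  then have r: "bl y = bl z"
    using assms by (subst bl_eq_iff) (auto simp: expd_def face_def)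
  have "y (crd (bl z) t) = z (crd (bl z) t)" if "t < S" for t
    using agree that by (auto simp: face_def A_def)
  moreover from this have "tm s y = tm s z"
    using assms(1) by (intro tm_cong r) (auto simp: expd_def)
  ultimately have "expd \<tau> i s y"
    using assms unfolding expd_def r by auto
  then show "\<exists>s'. expd \<tau> i s' y" by blast
qed

lemma expd_unique:
  assumes "expd \<tau> i s z" "expd \<tau> i s' y"
  shows "s = s'" "bl z = bl y"
  using assms tm_unique[of s z s' y] by (auto simp: expd_def)

lemma stage_expd_iff:
  assumes "v \<in> states n X"
  shows "expd \<tau> i s (stage \<tau> v) \<longleftrightarrow> s < S \<and> crd (bl v) s = i \<and> tm s v = \<tau>"
proof
  assume R: "s < S \<and> crd (bl v) s = i \<and> tm s v = \<tau>"
  have "\<not> \<tau> \<le> tm t v" if "t < s" for t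
    using R tm_strict_mono[OF that, of v] by simp
  with R have "tm s (stage \<tau> v) = tm s v"
    by (intro tm_cong bl_stage assms) (subst stage_crd, auto)
  with R show "expd \<tau> i s (stage \<tau> v)"
    using tm_mono[of s _ v] assms by (auto simp: expd_def bl_stage stage_states stage_crd)
next
  assume y: "expd \<tau> i s (stage \<tau> v)"
  have s: "s < S" and time: "tm s (stage \<tau> v) = \<tau>" using y by (auto simp: expd_def)
  \<comment> \<open>Times of \<open>stage \<tau> v\<close> and \<open>v\<close> could differ where
    coordinates are still at base. By strong induction all positions before \<open>s\<close> are
    already expanded, so there the times agree and lie below \<open>\<tau>\<close>.\<close>
  have before: "tm t v < \<tau>" if "t < s" for t
    using that
  proof (induction t rule: less_induct)
    case (less t)
    have "\<not> \<tau> \<le> tm u v" if "u < t" for u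
      using less.IH[of u] less.prems that by simp
    with less.prems s have "tm t (stage \<tau> v) = tm t v"
      by (intro tm_cong bl_stage assms) (subst stage_crd, auto)
    with tm_strict_mono[OF less.prems, of "stage \<tau> v"] time show ?case by simp
  qed
  have "\<not> \<tau> \<le> tm t v" if "t < s" for t
    using before[OF that] by simp
  with s have "tm s (stage \<tau> v) = tm s v"
    by (intro tm_cong bl_stage assms) (subst stage_crd, auto)
  with y time show "s < S \<and> crd (bl v) s = i \<and> tm s v = \<tau>"
    by (simp add: expd_def bl_stage[OF assms])
qed

section \<open>Directed layers in the limit\<close>

text \<open>The coordinates settled once block \<open>r\<close> has expanded \<open>s\<close> of its
  own; along this chain of sets the marginals telescope.\<close>

definition D :: "nat \<Rightarrow> nat \<Rightarrow> nat set" where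
  "D r s = {m+1..n} \<union> crd r ` {..<s}"

text \<open>Once the face is nonempty any of its states serves, since only data constant on the face
  are read off it.\<close>

definition chosen :: "nat \<Rightarrow> nat \<Rightarrow> nat \<times> (nat \<Rightarrow> 'a)" where
  "chosen \<tau> i = (SOME p. expd \<tau> i (fst p) (snd p))"

lemma chosen: "expd \<tau> i s z \<Longrightarrow> expd \<tau> i (fst (chosen \<tau> i)) (snd (chosen \<tau> i))"
  unfolding chosen_def by (rule someI[of _ "(s, z)"]) simp

text \<open>Of the coordinates that \<open>W\<close> reads here, the face fixes all but
  \<open>m + 1\<close>, and \<open>i\<close> is being set. So the weight depends on two states only
  and fits a pairwise interaction.\<close>

definition wt :: "nat \<Rightarrow> nat \<Rightarrow> 'a \<Rightarrow> 'a \<Rightarrow> real" where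
  "wt \<tau> i a b = W (D (bl (snd (chosen \<tau> i))) (Suc (fst (chosen \<tau> i)))) ((snd (chosen \<tau> i))(m+1 := b, i := a))"

text \<open>The weights of the directed layers are \<open>K * kA + kF\<close> with \<open>K \<rightarrow> \<infinity>\<close>. The direction \<open>kA\<close>
  makes unit \<open>i\<close> copy its input off the face and is constant in the new state on the face, where
  the finite part \<open>kF\<close> decides. Without a coordinate \<open>m + 1\<close>, i.e. for \<open>m = n\<close>, the finite part
  moves to the bias \<open>k0\<close>.\<close>

definition kA :: "nat \<Rightarrow> nat \<Rightarrow> nat \<Rightarrow> 'a \<Rightarrow> 'a \<Rightarrow> real" where
  "kA \<tau> i j a b =
    (if \<exists>s z. expd \<tau> i s z then
      (if j = i then if a = b \<and> b \<noteq> base i then real n + 1 else 0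
       else if j \<in> face (snd (chosen \<tau> i)) \<and> a = base i \<and> b \<noteq> snd (chosen \<tau> i) j then 1 else 0)
     else if j = i \<and> a = b then 1 else 0)"

definition kF :: "nat \<Rightarrow> nat \<Rightarrow> nat \<Rightarrow> 'a \<Rightarrow> 'a \<Rightarrow> real" where
  "kF \<tau> i j a b = (if (\<exists>s z. expd \<tau> i s z) \<and> j = m + 1 then ln (wt \<tau> i a b) else 0)"

definition k0 :: "nat \<Rightarrow> nat \<Rightarrow> 'a \<Rightarrow> real" where
  "k0 \<tau> i a = (if (\<exists>s z. expd \<tau> i s z) \<and> m = n then ln (wt \<tau> i a undefined) else 0)"

definition dir_unit :: "nat \<Rightarrow> real \<Rightarrow> nat \<Rightarrow> 'a \<Rightarrow> (nat \<Rightarrow> 'a) \<Rightarrow> real" where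
  "dir_unit \<tau> K = unit_weight n (\<lambda>i j a b. K * kA \<tau> i j a b + kF \<tau> i j a b) (k0 \<tau>)"

lemma dir_unit_eq:
  "dir_unit \<tau> K i a y = exp (K * (\<Sum>j=1..n. kA \<tau> i j a (y j)) + ((\<Sum>j=1..n. kF \<tau> i j a (y j)) + k0 \<tau> i a))"
  by (simp add: dir_unit_def unit_weight_def sum.distrib sum_distrib_left)

lemma finite_part:
  assumes "expd \<tau> i s z" "y \<in> states n X"
  shows "(\<Sum>j=1..n. kF \<tau> i j a (y j)) + k0 \<tau> i a = ln (wt \<tau> i a (y (m+1)))"
proof (cases "m = n")
  case True
  have "(\<Sum>j=1..n. kF \<tau> i j a (y j)) = 0"
    unfolding kF_def using True by (intro sum.neutral) auto
  moreover have "k0 \<tau> i a = ln (wt \<tau> i a undefined)"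
    using assms(1) True unfolding k0_def by (subst if_P) blast+
  \<comment> \<open>States are extensional, so a missing coordinate reads as
    \<open>undefined\<close>, the value stored in the bias.\<close>
  moreover have "y (m+1) = undefined"
    using True by (intro states_undefined[OF assms(2)]) simp
  ultimately show ?thesis by simp
next
  case False
  then have "(\<Sum>j=1..n. kF \<tau> i j a (y j)) = (\<Sum>j\<in>{1..n}. if j = m + 1 then ln (wt \<tau> i a (y j)) else 0)"
    using assms(1) by (intro sum.cong refl) (auto simp: kF_def)
  with False m_le show ?thesis by (simp add: k0_def)
qed

lemma expd_crd:
  assumes "expd \<tau> i s z"
  shows "i \<in> {1..m}" "i \<in> {1..n}" "i \<in> A (bl z)" "z i = base i" "z \<in> states n X"
proof -
  have "i = crd (bl z) s" "s < S" using assms by (auto simp: expd_def)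
  then show "i \<in> {1..m}" "i \<in> {1..n}" "i \<in> A (bl z)" "z i = base i" "z \<in> states n X"
    using crd[of "bl z" s] crd_n[of "bl z" s] assms by (auto simp: expd_def A_def)
qed

lemma wt_eq:
  assumes y: "expd \<tau> i s y"
  shows "wt \<tau> i a (y (m+1)) = W (D (bl y) (Suc s)) (y(i := a))"
proof -
  define z where "z = snd (chosen \<tau> i)"
  have z: "expd \<tau> i (fst (chosen \<tau> i)) z" using chosen[OF y] by (simp add: z_def)
  have eq: "fst (chosen \<tau> i) = s" "bl z = bl y" using expd_unique[OF z y] by auto
  have agree: "\<forall>j\<in>face z. y j = z j"
    using expd_face_iff[OF z expd_crd(5)[OF y]] y by blast
  have s: "s < S" using y by (simp add: expd_def)
  have "W (D (bl y) (Suc s)) (z(m+1 := y (m+1), i := a)) = W (D (bl y) (Suc s)) (y(i := a))"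
  proof (rule W_cong)
    fix j assume "j \<in> D (bl y) (Suc s)"
    then have "j = m + 1 \<or> j \<in> face z"
      using s eq(2) by (force simp: D_def face_def A_def less_Suc_eq_le)
    then show "(z(m+1 := y (m+1), i := a)) j = (y(i := a)) j"
      using agree by auto
  qed
  then show ?thesis by (simp add: wt_def eq flip: z_def)
qed

lemma W_expd:
  assumes y: "expd \<tau> i s y"
  shows "(\<Sum>a\<in>X i. W (D (bl y) (Suc s)) (y(i := a))) = W (D (bl y) s) y"
proof -
  have i: "i = crd (bl y) s" "s < S" using y by (auto simp: expd_def)
  have "i \<notin> D (bl y) s"
    using i expd_crd(1)[OF y] crd_inj_right[of "bl y" s] by (fastforce simp: D_def)
  moreover have "D (bl y) (Suc s) = insert i (D (bl y) s)"
    using i by (auto simp: D_def less_Suc_eq)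
  ultimately show ?thesis
    using W_refine[OF expd_crd(5)[OF y] expd_crd(2)[OF y]] by simp
qed

text \<open>On the face the coefficient of \<open>K\<close> vanishes for every new state: unit
  \<open>i\<close> is at base, so copying earns nothing, and no face coordinate deviates. The
  quotient is constant in \<open>K\<close>, with normaliser from \<open>W_expd\<close>.\<close>

lemma unit_expd:
  assumes y: "expd \<tau> i s y" and a: "a \<in> X i"
  shows "((\<lambda>K. dir_unit \<tau> K i a y / (\<Sum>a'\<in>X i. dir_unit \<tau> K i a' y))
    \<longlongrightarrow> W (D (bl y) (Suc s)) (y(i := a)) / W (D (bl y) s) y) at_top"
proof -
  note ys = expd_crd(5)[OF y] and i = expd_crd(2)[OF y]
  have agree: "\<forall>j\<in>face (snd (chosen \<tau> i)). y j = snd (chosen \<tau> i) j"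
    using expd_face_iff[OF chosen[OF y] ys] y by blast
  have const: "(\<Sum>j=1..n. kA \<tau> i j b (y j)) = 0" for b
    using y agree expd_crd(4)[OF y] by (intro sum.neutral) (auto simp: kA_def)
  have F: "exp ((\<Sum>j=1..n. kF \<tau> i j b (y j)) + k0 \<tau> i b) = W (D (bl y) (Suc s)) (y(i := b))"
    if "b \<in> X i" for b
    using W_pos[OF states_upd[OF ys i that]] unfolding finite_part[OF y ys] wt_eq[OF y] by simp
  have "(\<lambda>K. dir_unit \<tau> K i a y / (\<Sum>a'\<in>X i. dir_unit \<tau> K i a' y)) =
      (\<lambda>K. W (D (bl y) (Suc s)) (y(i := a)) / W (D (bl y) s) y)"
    unfolding dir_unit_eq const using F a W_expd[OF y] by simp
  then show ?thesis by simp
qed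

text \<open>If unit \<open>i\<close> is not at base, copying earns \<open>n + 1\<close>, more than
  the at most \<open>n\<close> deviations in favour of \<open>base i\<close>. If it is at base,
  staying earns the number of deviations, which is positive off the face, and any other state earns
  0.\<close>

lemma unit_copy:
  assumes ys: "y \<in> states n X" and i: "i \<in> {1..n}" and nexp: "\<And>s. \<not> expd \<tau> i s y"
  shows "((\<lambda>K. dir_unit \<tau> K i (y i) y / (\<Sum>a'\<in>X i. dir_unit \<tau> K i a' y)) \<longlongrightarrow> 1) at_top"
proof -
  define B where "B a = (\<Sum>j=1..n. kA \<tau> i j a (y j))" for a
  have strict: "B a < B (y i)" if "a \<noteq> y i" for a
  proof (cases "\<exists>s z. expd \<tau> i s z")
    case False
    then have "B a = (\<Sum>j=1..n. if j = i then if a = y j then 1 else 0 else 0)" for a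
      unfolding B_def by (intro sum.cong) (auto simp: kA_def)
    then have "B a = (if a = y i then 1 else 0)" for a
      using i by simp
    with that show ?thesis by simp
  next
    case True
    then obtain s z' where "expd \<tau> i s z'" by blast
    from chosen[OF this] obtain s z where z: "expd \<tau> i s z" and z_eq: "z = snd (chosen \<tau> i)" by blast
    define M where "M = {j \<in> {1..n} - {i}. j \<in> face z \<and> y j \<noteq> z j}"
    have B: "B a = (if a = y i \<and> y i \<noteq> base i then real n + 1 else 0) +
        (if a = base i then real (card M) else 0)" for a
    proof -
      have "B a = kA \<tau> i i a (y i) + (\<Sum>j\<in>{1..n} - {i}. kA \<tau> i j a (y j))"
        unfolding B_def using i by (intro sum.remove) auto
      also have "(\<Sum>j\<in>{1..n} - {i}. kA \<tau> i j a (y j)) =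
          (\<Sum>j\<in>{1..n} - {i}. if j \<in> face z \<and> y j \<noteq> z j then if a = base i then 1 else 0 else 0)"
        using True by (intro sum.cong) (auto simp: kA_def z_eq)
      also have "\<dots> = (\<Sum>j\<in>M. if a = base i then 1 else 0)"
        unfolding M_def by (rule sum.inter_filter[symmetric]) simp
      finally show ?thesis using True by (auto simp: kA_def)
    qed
    have "card M \<le> card {1..n}" unfolding M_def by (intro card_mono) auto
    then have "real (card M) \<le> real n" by simp
    \<comment> \<open>\<open>y\<close> is off the face, and the deviating coordinate is not
      \<open>i\<close>, because \<open>z\<close> is at base there as well.\<close>
    moreover have "card M > 0" if "y i = base i"
    proof -
      obtain j where "j \<in> face z" "y j \<noteq> z j"
        using expd_face_iff[OF z ys] nexp by blast
      moreover from this have "j \<noteq> i" "j \<in> {1..n}"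
        using that expd_crd(4)[OF z] A_subset[of "bl z"] m_le by (auto simp: face_def)
      ultimately have "j \<in> M" by (simp add: M_def)
      then show ?thesis by (auto simp: M_def card_gt_0_iff)
    qed
    ultimately show ?thesis
      unfolding B using that by auto
  qed
  have "((\<lambda>K. dir_unit \<tau> K i (y i) y / (\<Sum>a'\<in>X i. dir_unit \<tau> K i a' y))
    \<longlongrightarrow> exp ((\<Sum>j=1..n. kF \<tau> i j (y i) (y j)) + k0 \<tau> i (y i)) /
      (\<Sum>a'\<in>{a' \<in> X i. B a' = B (y i)}. exp ((\<Sum>j=1..n. kF \<tau> i j a' (y j)) + k0 \<tau> i a'))) at_top"
    unfolding dir_unit_eq B_def[symmetric]
    using fin[OF i] states_mem[OF ys i]
  proof (rule softmax_tendsto)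
    show "B a \<le> B (y i)" for a
      using strict[of a] by (cases "a = y i") auto
  qed
  moreover have "{a' \<in> X i. B a' = B (y i)} = {y i}"
    using strict states_mem[OF ys i] by force
  ultimately show ?thesis by simp
qed

text \<open>The conditional probability under \<open>P\<close> of coordinate number \<open>s\<close>
  of \<open>v\<close>, given the coordinates settled before it.\<close>

definition ratio :: "(nat \<Rightarrow> 'a) \<Rightarrow> nat \<Rightarrow> real" where
  "ratio v s = W (D (bl v) (Suc s)) v / W (D (bl v) s) v"

lemma W_stage:
  assumes "v \<in> states n X" "s \<le> S" "\<And>t. t < s \<Longrightarrow> tm t v < \<tau>"
  shows "W (D (bl v) s) (stage \<tau> v) = W (D (bl v) s) v"
proof (rule W_cong)
  fix i assume "i \<in> D (bl v) s"
  then consider "i \<in> {m+1..n}" | t where "t < s" "i = crd (bl v) t" by (auto simp: D_def)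
  then show "stage \<tau> v i = v i"
    using assms(2,3) by cases (force simp: stage_outside stage_crd)+
qed

text \<open>The product has at most one factor: it is empty for a copying unit and a single
  \<open>ratio\<close> for an expanding one. This form lets all layers and units be regrouped
  later.\<close>

lemma unit_stage:
  assumes v: "v \<in> states n X" and i: "i \<in> {1..n}"
  shows "((\<lambda>K. dir_unit \<tau> K i (stage (Suc \<tau>) v i) (stage \<tau> v) /
      (\<Sum>a\<in>X i. dir_unit \<tau> K i a (stage \<tau> v)))
    \<longlongrightarrow> (\<Prod>s\<in>{s \<in> {..<S}. (tm s v, crd (bl v) s) = (\<tau>, i)}. ratio v s)) at_top"
proof (cases "\<exists>s<S. (tm s v, crd (bl v) s) = (\<tau>, i)")
  case True
  then obtain s where s: "s < S" "tm s v = \<tau>" "crd (bl v) s = i" by blast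
  have "{s \<in> {..<S}. (tm s v, crd (bl v) s) = (\<tau>, i)} = {s}"
    using s crd_inj_right by auto
  moreover have "expd \<tau> i s (stage \<tau> v)"
    using s v by (simp add: stage_expd_iff)
  from unit_expd[OF this states_mem[OF stage_states[OF v] i], of "Suc \<tau>"]
  have "((\<lambda>K. dir_unit \<tau> K i (stage (Suc \<tau>) v i) (stage \<tau> v) /
      (\<Sum>a\<in>X i. dir_unit \<tau> K i a (stage \<tau> v)))
    \<longlongrightarrow> W (D (bl v) (Suc s)) ((stage \<tau> v)(i := stage (Suc \<tau>) v i)) / W (D (bl v) s) (stage \<tau> v)) at_top"
    by (simp add: bl_stage v)
  moreover have "W (D (bl v) s) (stage \<tau> v) = W (D (bl v) s) v"
    using v s tm_strict_mono[of _ s v] by (intro W_stage) auto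
  moreover have "W (D (bl v) (Suc s)) ((stage \<tau> v)(i := stage (Suc \<tau>) v i)) = W (D (bl v) (Suc s)) v"
  proof (rule W_cong)
    fix j assume "j \<in> D (bl v) (Suc s)"
    then consider "j \<in> {m+1..n}" | t where "t < s" "j = crd (bl v) t" | "j = i"
      using s by (auto simp: D_def less_Suc_eq)
    then show "((stage \<tau> v)(i := stage (Suc \<tau>) v i)) j = v j"
    proof cases
      case 1
      then show ?thesis by (simp add: stage_outside)
    next
      case 2
      then show ?thesis
        using s tm_strict_mono[OF 2(1), of v] stage_crd[of s "Suc \<tau>" v] by (simp add: stage_crd)
    next
      case 3
      then show ?thesis
        using s stage_crd[of s "Suc \<tau>" v] by simp
    qed
  qed
  ultimately show ?thesis by (simp add: ratio_def)
next
  case False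
  then have "{s \<in> {..<S}. (tm s v, crd (bl v) s) = (\<tau>, i)} = {}" by blast
  moreover have "stage (Suc \<tau>) v i = stage \<tau> v i"
    using False by (auto simp: stage_def Suc_le_eq le_less)
  moreover have nexp: "\<not> expd \<tau> i s (stage \<tau> v)" for s
    using False v by (auto simp: stage_expd_iff)
  note unit_copy[OF stage_states[OF v] i nexp]
  ultimately show ?thesis by (simp only: prod.empty)
qed

section \<open>The deepest pair of layers\<close>

text \<open>Codes need not exhaust \<open>{1..m}\<close>; a hidden unit whose index codes no block
  gets penalised off base.\<close>

definition has_block :: "nat \<Rightarrow> bool" where
  "has_block j \<longleftrightarrow> (\<exists>z\<in>states n X. bl z = j)"

definition rep :: "nat \<Rightarrow> nat \<Rightarrow> 'a" where
  "rep j = (SOME z. z \<in> states n X \<and> bl z = j)"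

lemma rep: "has_block j \<Longrightarrow> rep j \<in> states n X \<and> bl (rep j) = j"
  unfolding rep_def has_block_def by (rule someI_ex[of "\<lambda>z. z \<in> states n X \<and> bl z = j"]) blast

definition mis :: "nat \<Rightarrow> nat \<Rightarrow> 'a \<Rightarrow> bool" where
  "mis i j a \<longleftrightarrow> i \<in> {m+2..n} \<and> a \<noteq> rep j i \<or> i \<in> A j \<and> a \<noteq> base i"

text \<open>The marginal on the coordinates from \<open>m + 1\<close> on, spread evenly over the
  \<open>N j\<close> settings left uniform.\<close>

definition start_wt :: "nat \<Rightarrow> 'a \<Rightarrow> real" where
  "start_wt j a = W {m+1..n} ((rep j)(m+1 := a)) / N j"

text \<open>Hidden unit \<open>j\<close> of the deepest layer is in state \<open>alt j\<close> exactly on block \<open>j\<close>. As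
  \<open>K \<rightarrow> \<infinity>\<close> the machine becomes a mixture over the blocks, with base states on \<open>A j\<close> and uniform
  on the remaining coordinates up to \<open>m\<close>.\<close>

definition r_theta :: "real \<Rightarrow> nat \<Rightarrow> nat \<Rightarrow> 'a \<Rightarrow> 'a \<Rightarrow> real" where
  "r_theta K i j a b =
    (if has_block j \<and> b = alt j
     then K * (if mis i j a then - 2 else 0) + (if i = m + 1 then ln (start_wt j a) else 0) else 0)"

definition r_bias :: "real \<Rightarrow> nat \<Rightarrow> 'a \<Rightarrow> real" where
  "r_bias K j b =
    (if b = base j then 0
     else if has_block j \<and> b = alt j then K + (if m = n then ln (start_wt j undefined) else 0)
     else - K)"

text \<open>The coefficient of \<open>K\<close> contributed by hidden unit \<open>j\<close>, with
  \<open>f\<close> as finite part. One mismatch costs 2 and so outweighs the gain 1 of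
  \<open>alt j\<close>.\<close>

definition u :: "(nat \<Rightarrow> 'a) \<Rightarrow> nat \<Rightarrow> 'a \<Rightarrow> real" where
  "u x j b =
    (if b = base j then 0
     else if has_block j \<and> b = alt j then 1 - 2 * real (card {i \<in> {1..n}. mis i j (x i)})
     else - 1)"

definition f :: "(nat \<Rightarrow> 'a) \<Rightarrow> nat \<Rightarrow> 'a \<Rightarrow> real" where
  "f x j b = (if has_block j \<and> b = alt j then ln (start_wt j (x (m+1))) else 0)"

definition hid :: "nat \<Rightarrow> nat \<Rightarrow> 'a" where
  "hid r = (\<lambda>i\<in>{1..n}. if i = r then alt i else base i)"

definition started :: "(nat \<Rightarrow> 'a) \<Rightarrow> bool" where
  "started x \<longleftrightarrow> (\<forall>i\<in>A (bl x). x i = base i)"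

lemma hid_states: "hid r \<in> states n X"
  using base alt by (auto simp: hid_def states_def)

lemma hidden_unit:
  assumes x: "x \<in> states n X" and j: "j \<in> {1..n}"
  shows "(\<Sum>i=1..n. r_theta K i j (x i) b) + r_bias K j b = K * u x j b + f x j b"
proof (cases "has_block j \<and> b = alt j")
  case False
  then have "r_theta K i j (x i) b = 0" for i
    unfolding r_theta_def by (rule if_not_P)
  with False alt(2)[OF j] show ?thesis by (auto simp: r_bias_def u_def f_def)
next
  case True
  define l where "l a = ln (start_wt j a)" for a
  have mis: "(\<Sum>i=1..n. K * (if mis i j (x i) then - 2 else 0)) = K * (- 2 * real (card {i \<in> {1..n}. mis i j (x i)}))"
    unfolding sum_distrib_left[symmetric] by (subst sum.inter_filter[symmetric]) simp_all
  define e where "e = (\<Sum>i=1..n. if i = m + 1 then l (x i) else 0)"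
  define e' where "e' = (if m = n then l undefined else 0)"
  have l: "e + e' = l (x (m+1))"
  proof (cases "m = n")
    case True
    have "e = 0"
      unfolding e_def using True by (intro sum.neutral) auto
    moreover have "x (m+1) = undefined"
      using True by (intro states_undefined[OF x]) simp
    ultimately show ?thesis using True by (simp add: e'_def)
  next
    case False
    then show ?thesis using m_le by (simp add: e_def e'_def)
  qed
  have "(\<Sum>i=1..n. r_theta K i j (x i) b) =
      (\<Sum>i=1..n. K * (if mis i j (x i) then - 2 else 0)) + e"
    unfolding e_def sum.distrib[symmetric] l_def r_theta_def by (intro sum.cong refl if_P True)
  moreover have "r_bias K j b = K + e'"
    using True alt(2)[OF j] by (simp add: r_bias_def l_def e'_def)
  moreover have "u x j b = 1 - 2 * real (card {i \<in> {1..n}. mis i j (x i)})"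
    using True alt(2)[OF j] by (simp add: u_def)
  moreover have "f x j b = e + e'"
    unfolding l using True by (simp add: f_def l_def)
  ultimately show ?thesis by (simp only: mis) (simp add: algebra_simps)
qed

lemma rbm_weight_eq:
  assumes "x \<in> states n X"
  shows "rbm_weight n (r_theta K) (\<lambda>_ _. 0) (r_bias K) x y =
    exp (K * (\<Sum>j=1..n. u x j (y j)) + (\<Sum>j=1..n. f x j (y j)))"
proof -
  have "(\<Sum>i=1..n. \<Sum>j=1..n. r_theta K i j (x i) (y j)) + (\<Sum>j=1..n. r_bias K j (y j)) =
      (\<Sum>j=1..n. (\<Sum>i=1..n. r_theta K i j (x i) (y j)) + r_bias K j (y j))"
    unfolding sum.distrib by (subst sum.swap) simp
  also have "\<dots> = (\<Sum>j=1..n. K * u x j (y j) + f x j (y j))"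
    using hidden_unit[OF assms] by (intro sum.cong) auto
  finally show ?thesis
    by (simp add: rbm_weight_def sum.distrib sum_distrib_left)
qed

text \<open>On a foreign block a mismatch pushes \<open>alt j\<close> to at most -1, below the 0 of
  \<open>base j\<close>; on its own block \<open>alt j\<close> reaches 1 only without mismatch. The
  bounds sum to 1 for every \<open>x\<close>, so all started states tie.\<close>

lemma u_bound:
  assumes x: "x \<in> states n X" and j: "j \<in> {1..n}"
  shows "u x j b \<le> (if j = bl x then 1 else 0)"
    and "u x j b = (if j = bl x then 1 else 0) \<Longrightarrow>
      b = (if j = bl x then alt j else base j) \<and> (j = bl x \<longrightarrow> started x)"
proof -
  have off: "card {i \<in> {1..n}. mis i j (x i)} > 0" if "has_block j" "j \<noteq> bl x"
  proof -
    have "\<not> (\<forall>i\<in>{m+2..n}. x i = rep j i)"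
      using rep[OF that(1)] that(2) bl_eq_iff[OF x, of "rep j"] by auto
    then have "{i \<in> {1..n}. mis i j (x i)} \<noteq> {}" by (auto simp: mis_def)
    then show ?thesis by (simp add: card_gt_0_iff)
  qed
  have on: "started x" if "card {i \<in> {1..n}. mis i j (x i)} = 0" "j = bl x"
  proof -
    have "\<not> mis i j (x i)" if "i \<in> {1..n}" for i
      using \<open>card _ = 0\<close> that by (auto simp: card_eq_0_iff)
    then show ?thesis
      using A_subset[of j] m_le that(2) by (fastforce simp: started_def mis_def)
  qed
  show "u x j b \<le> (if j = bl x then 1 else 0)"
    using off by (force simp: u_def)
  show "b = (if j = bl x then alt j else base j) \<and> (j = bl x \<longrightarrow> started x)"
    if "u x j b = (if j = bl x then 1 else 0)"
    using that off on alt(2)[OF j] by (auto simp: u_def split: if_splits)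
qed

lemma bl_n: "x \<in> states n X \<Longrightarrow> bl x \<in> {1..n}"
  using bl[of x] m_le by auto

lemma u_started:
  assumes x: "x \<in> states n X" "started x"
  shows "(\<Sum>j=1..n. u x j (hid (bl x) j)) = 1"
proof -
  have hb: "has_block (bl x)" using x by (auto simp: has_block_def)
  have "x i = rep (bl x) i" if "i \<in> {m+2..n}" for i
    using rep[OF hb] bl_eq_iff[OF x(1), of "rep (bl x)"] that by auto
  then have "{i \<in> {1..n}. mis i (bl x) (x i)} = {}"
    using x by (auto simp: mis_def started_def)
  then have "u x j (hid (bl x) j) = (if j = bl x then 1 else 0)" if "j \<in> {1..n}" for j
    using that hb alt(2)[OF that] by (auto simp: u_def hid_def)
  then have "(\<Sum>j=1..n. u x j (hid (bl x) j)) = (\<Sum>j=1..n. if j = bl x then 1 else 0)"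
    by (intro sum.cong) auto
  then show ?thesis using bl_n[OF x(1)] by simp
qed

lemma f_started:
  assumes x: "x \<in> states n X"
  shows "exp (\<Sum>j=1..n. f x j (hid (bl x) j)) = W {m+1..n} x / N (bl x)"
proof -
  have hb: "has_block (bl x)" using x by (auto simp: has_block_def)
  have "f x j (hid (bl x) j) = (if j = bl x then ln (start_wt (bl x) (x (m+1))) else 0)" if "j \<in> {1..n}" for j
    using that hb alt(2)[OF that] by (auto simp: f_def hid_def)
  then have "(\<Sum>j=1..n. f x j (hid (bl x) j)) = (\<Sum>j=1..n. if j = bl x then ln (start_wt (bl x) (x (m+1))) else 0)"
    by (intro sum.cong) auto
  then have "(\<Sum>j=1..n. f x j (hid (bl x) j)) = ln (start_wt (bl x) (x (m+1)))"
    using bl_n[OF x] by simp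
  moreover have "W {m+1..n} ((rep (bl x))(m+1 := x (m+1))) = W {m+1..n} x"
    using rep[OF hb] bl_eq_iff[OF x, of "rep (bl x)"] by (intro W_cong) auto
  ultimately show ?thesis
    using W_pos[OF x, of "{m+1..n}"] N_pos[of "bl x"] by (simp add: start_wt_def)
qed

text \<open>Double counting: exactly \<open>N (bl x')\<close> started states agree with
  \<open>x'\<close> from \<open>m + 1\<close> on, so swapping the sums cancels the division by
  \<open>N\<close>.\<close>

lemma start_total: "(\<Sum>x\<in>{x \<in> states n X. started x}. W {m+1..n} x / N (bl x)) = 1"
proof -
  have cell: "card {x \<in> {x \<in> states n X. started x}. \<forall>i\<in>{m+1..n}. x' i = x i} = N (bl x')"
    if x': "x' \<in> states n X" for x'
  proof -
    let ?D = "{m+1..n} \<union> A (bl x')"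
    \<comment> \<open>Resetting the expanded coordinates of \<open>x'\<close> to base exhibits the
      fibre over \<open>x'\<close> as a cylinder.\<close>
    define x0 where "x0 i = (if i \<in> A (bl x') then base i else x' i)" for i
    have A: "i \<in> {1..m}" if "i \<in> A r" for i r using A_subset that by blast
    have x0: "x0 \<in> states n X"
      using x' base A m_le unfolding x0_def states_def by (fastforce simp: PiE_iff extensional_def)
    have same: "bl x = bl x'" if "x \<in> states n X" "\<forall>i\<in>{m+1..n}. x' i = x i" for x
      using that by (subst bl_eq_iff[OF _ x']) auto
    have "{x \<in> {x \<in> states n X. started x}. \<forall>i\<in>{m+1..n}. x' i = x i} = cyl ?D x0"
    proof (intro set_eqI iffI)
      fix x assume "x \<in> {x \<in> {x \<in> states n X. started x}. \<forall>i\<in>{m+1..n}. x' i = x i}"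
      with same[of x] show "x \<in> cyl ?D x0"
        by (auto simp: cyl_def x0_def started_def)
    next
      fix x assume x: "x \<in> cyl ?D x0"
      have agree: "\<forall>i\<in>{m+1..n}. x' i = x i"
      proof
        fix i assume i: "i \<in> {m+1..n}"
        then have "i \<notin> A (bl x')" using A[of i "bl x'"] by auto
        with i x show "x' i = x i" by (auto simp: cyl_def x0_def)
      qed
      with x same[of x] show "x \<in> {x \<in> {x \<in> states n X. started x}. \<forall>i\<in>{m+1..n}. x' i = x i}"
        by (auto simp: cyl_def x0_def started_def)
    qed
    moreover have "?D \<subseteq> {1..n}" using A m_le by fastforce
    moreover have "{1..n} - ?D = {1..m} - A (bl x')" using m_le by auto
    ultimately show ?thesis using card_cyl[OF x0, of ?D] by (simp add: N_def)
  qed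
  have "(\<Sum>x\<in>{x \<in> states n X. started x}. W {m+1..n} x / N (bl x)) =
      (\<Sum>x\<in>{x \<in> states n X. started x}. \<Sum>x'\<in>{x' \<in> states n X. \<forall>i\<in>{m+1..n}. x' i = x i}. P x' / N (bl x'))"
  proof (rule sum.cong[OF refl])
    fix x assume x: "x \<in> {x \<in> states n X. started x}"
    have "bl x' = bl x" if "x' \<in> cyl {m+1..n} x" for x'
      using x that by (subst bl_eq_iff) (auto simp: cyl_def)
    then have "W {m+1..n} x / N (bl x) = (\<Sum>x'\<in>cyl {m+1..n} x. P x' / N (bl x'))"
      by (simp add: W_def sum_divide_distrib)
    then show "W {m+1..n} x / N (bl x) =
        (\<Sum>x'\<in>{x' \<in> states n X. \<forall>i\<in>{m+1..n}. x' i = x i}. P x' / N (bl x'))"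
      by (simp only: cyl_def)
  qed
  also have "\<dots> = (\<Sum>x'\<in>states n X. \<Sum>x\<in>{x \<in> {x \<in> states n X. started x}. \<forall>i\<in>{m+1..n}. x' i = x i}. P x' / N (bl x'))"
    using fin_states by (intro sum.swap_restrict) auto
  also have "\<dots> = (\<Sum>x'\<in>states n X. P x')"
    using cell N_pos by (intro sum.cong) (auto simp: less_imp_neq[symmetric])
  finally show ?thesis by (simp add: P_sum)
qed

lemma rbm_limit:
  assumes x: "x \<in> states n X" and st: "started x"
  shows "\<exists>l. l \<ge> W {m+1..n} x / N (bl x) \<and>
    ((\<lambda>K. rbm_prob n X (r_theta K) (\<lambda>_ _. 0) (r_bias K) x (hid (bl x))) \<longlongrightarrow> l) at_top"
proof -
  define Z where "Z = states n X \<times> states n X"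
  define B where "B p = (\<Sum>j=1..n. u (fst p) j (snd p j))" for p
  define F where "F p = (\<Sum>j=1..n. f (fst p) j (snd p j))" for p
  define p0 where "p0 = (x, hid (bl x))"
  have bl_sum: "(\<Sum>j=1..n. if j = bl y then 1 else 0 :: real) = 1" if "y \<in> states n X" for y
    using bl_n[OF that] by simp
  have B0: "B p0 = 1" using u_started[OF x st] by (simp add: B_def p0_def)
  have B_le: "B p \<le> B p0" if "p \<in> Z" for p
  proof -
    have p: "fst p \<in> states n X" using that by (auto simp: Z_def)
    have "B p \<le> (\<Sum>j=1..n. if j = bl (fst p) then 1 else 0)"
      unfolding B_def using u_bound(1)[OF p] by (intro sum_mono)
    then show ?thesis using bl_sum[OF p] B0 by simp
  qed
  \<comment> \<open>This inclusion and \<open>start_total\<close> bound the limiting normaliser by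
    1, hence the limit from below.\<close>
  have argmax: "{p \<in> Z. B p = B p0} \<subseteq> (\<lambda>y. (y, hid (bl y))) ` {y \<in> states n X. started y}"
  proof
    fix p assume "p \<in> {p \<in> Z. B p = B p0}"
    then obtain y h where p: "p = (y, h)" "y \<in> states n X" "h \<in> states n X" and B1: "B (y, h) = 1"
      using B0 by (auto simp: Z_def)
    \<comment> \<open>The total attains the sum of the termwise bounds, so every term attains its
      bound.\<close>
    have eq: "u y j (h j) = (if j = bl y then 1 else 0)" if "j \<in> {1..n}" for j
    proof (rule sum_mono_inv[where f = "\<lambda>j. u y j (h j)" and I = "{1..n}"])
      show "(\<Sum>j=1..n. u y j (h j)) = (\<Sum>j=1..n. if j = bl y then 1 else 0)"
        using B1 bl_sum[OF p(2)] by (simp add: B_def)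
    qed (use u_bound(1)[OF p(2)] that in auto)
    note h = u_bound(2)[OF p(2) _ eq]
    have "h = hid (bl y)"
    proof
      fix j show "h j = hid (bl y) j"
        using h[of j] states_undefined[OF p(3), of j] by (cases "j \<in> {1..n}") (auto simp: hid_def)
    qed
    moreover have "started y" using h[of "bl y"] bl_n[OF p(2)] by simp
    ultimately show "p \<in> (\<lambda>y. (y, hid (bl y))) ` {y \<in> states n X. started y}"
      using p by blast
  qed
  have F_eq: "exp (F (y, hid (bl y))) = W {m+1..n} y / N (bl y)" if "y \<in> states n X" for y
    using f_started[OF that] by (simp add: F_def)
  have "(\<Sum>p\<in>{p \<in> Z. B p = B p0}. exp (F p)) \<le>
      (\<Sum>p\<in>(\<lambda>y. (y, hid (bl y))) ` {y \<in> states n X. started y}. exp (F p))"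
    using fin_states argmax by (intro sum_mono2) auto
  also have "\<dots> = (\<Sum>y\<in>{y \<in> states n X. started y}. exp (F (y, hid (bl y))))"
    by (subst sum.reindex) (auto simp: inj_on_def)
  also have "\<dots> = 1"
    using F_eq start_total by simp
  finally have Z_le: "(\<Sum>p\<in>{p \<in> Z. B p = B p0}. exp (F p)) \<le> 1" .
  have fin_Z: "finite Z" using fin_states by (simp add: Z_def)
  have p0_Z: "p0 \<in> Z" using x hid_states by (simp add: p0_def Z_def)
  have Z_pos: "0 < (\<Sum>p\<in>{p \<in> Z. B p = B p0}. exp (F p))"
  proof (rule sum_pos)
    show "{p \<in> Z. B p = B p0} \<noteq> {}" using p0_Z by blast
  qed (use fin_Z in auto)
  have "rbm_prob n X (r_theta K) (\<lambda>_ _. 0) (r_bias K) x (hid (bl x)) =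
      exp (K * B p0 + F p0) / (\<Sum>p\<in>Z. exp (K * B p + F p))" for K
  proof -
    have "(\<Sum>x'\<in>states n X. \<Sum>y'\<in>states n X. rbm_weight n (r_theta K) (\<lambda>_ _. 0) (r_bias K) x' y') =
        (\<Sum>x'\<in>states n X. \<Sum>y'\<in>states n X. exp (K * B (x', y') + F (x', y')))"
      by (intro sum.cong) (auto simp: rbm_weight_eq B_def F_def)
    also have "\<dots> = (\<Sum>p\<in>Z. exp (K * B p + F p))"
      by (simp add: sum.cartesian_product Z_def case_prod_unfold)
    finally show ?thesis
      by (simp add: rbm_prob_def rbm_weight_eq[OF x] B_def F_def p0_def)
  qed
  moreover have "((\<lambda>K. exp (K * B p0 + F p0) / (\<Sum>p\<in>Z. exp (K * B p + F p)))
      \<longlongrightarrow> exp (F p0) / (\<Sum>p\<in>{p \<in> Z. B p = B p0}. exp (F p))) at_top"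
    using fin_Z p0_Z B_le by (rule softmax_tendsto)
  moreover have "exp (F p0) / (\<Sum>p\<in>{p \<in> Z. B p = B p0}. exp (F p)) \<ge> exp (F p0)"
    using Z_le Z_pos by (simp add: field_simps)
  ultimately show ?thesis
    using F_eq[OF x] unfolding p0_def by auto
qed

section \<open>Limit of the visible marginal\<close>

text \<open>Along the path that builds \<open>v\<close> from its block, the factors telescope to \<open>W (D (bl v) S) v\<close>.\<close>

lemma marginal_limit:
  assumes v: "v \<in> states n X" and L: "L \<ge> 2" "(\<Sum>t<S. Q ^ t) \<le> L - 2"
    and less: "c < P v / N (bl v)"
  shows "eventually (\<lambda>K. c < dbn_marginal n X L (r_theta K) (\<lambda>_ _. 0) (r_bias K)
    (\<lambda>l i j a b. K * kA (L-2-l) i j a b + kF (L-2-l) i j a b) (\<lambda>l. k0 (L-2-l)) v) at_top"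
proof -
  define \<theta>d where "\<theta>d K l i j a b = K * kA (L-2-l) i j a b + kF (L-2-l) i j a b" for K l i j a b
  define ad where "ad l = k0 (L-2-l)" for l
  \<comment> \<open>One path bounds the marginal from below. Time runs against the layer index:
    layer \<open>l\<close> holds stage \<open>L - 1 - l\<close>, and the kernel from
    \<open>l + 1\<close> to \<open>l\<close> performs step \<open>L - 2 - l\<close>.\<close>
  define h where "h = (\<lambda>l\<in>{1..L}. if l = L then hid (bl v) else stage (L-1-l) v)"
  define J where "J K = dbn_joint n X L (r_theta K) (\<lambda>_ _. 0) (r_bias K) (\<theta>d K) ad" for K
  have fin_paths: "finite {h \<in> PiE {1..L} (\<lambda>_. states n X). h 1 = v}"
    by (intro finite_subset[OF _ finite_PiE[of "{1..L}" "\<lambda>_. states n X"]]) (auto intro: fin_states)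
  have h1: "h 1 = v"
  proof -
    have "h 1 = stage (L - 2) v" using L(1) by (simp add: h_def numeral_2_eq_2)
    then show ?thesis using stage_final[OF v L(2)] by simp
  qed
  have h_path: "h \<in> {h \<in> PiE {1..L} (\<lambda>_. states n X). h 1 = v}"
    using h1 hid_states stage_states[OF v] by (auto simp: h_def)
  have J_nonneg: "J K h' \<ge> 0" for K h'
    unfolding J_def dbn_joint_def
    by (intro mult_nonneg_nonneg prod_nonneg less_imp_le[OF rbm_prob_pos] ballI
        less_imp_le[OF layer_kernel_pos] X_fin_ne)
  have J_le: "J K h \<le> dbn_marginal n X L (r_theta K) (\<lambda>_ _. 0) (r_bias K) (\<theta>d K) ad v" for K
    unfolding dbn_marginal_def J_def[symmetric]
    by (rule member_le_sum[OF h_path J_nonneg fin_paths])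
  have h0: "stage 0 v \<in> states n X" "bl (stage 0 v) = bl v" "started (stage 0 v)"
    using v by (auto simp: stage_states bl_stage started_def A_def stage_crd)
  have W0: "W {m+1..n} (stage 0 v) = W (D (bl v) 0) v"
    unfolding D_def by (simp del: One_nat_def) (rule W_cong, simp add: stage_outside)
  obtain l0 where l0: "l0 \<ge> W (D (bl v) 0) v / N (bl v)"
    and l0_lim: "((\<lambda>K. rbm_prob n X (r_theta K) (\<lambda>_ _. 0) (r_bias K) (stage 0 v) (hid (bl v))) \<longlongrightarrow> l0) at_top"
    using rbm_limit[OF h0(1,3)] unfolding h0(2) W0 by blast
  define \<kappa> where "\<kappa> \<tau> i = (\<Prod>s\<in>{s \<in> {..<S}. (tm s v, crd (bl v) s) = (\<tau>, i)}. ratio v s)" for \<tau> i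
  have layer: "((\<lambda>K. layer_kernel n X (\<theta>d K l) (ad l) (h l) (h (l+1))) \<longlongrightarrow> (\<Prod>i=1..n. \<kappa> (L-2-l) i)) at_top"
    if l: "l \<in> {1..L-2}" for l
  proof -
    have "h l = stage (Suc (L-2-l)) v" "h (l+1) = stage (L-2-l) v"
      using l by (auto simp: h_def Suc_diff_le[symmetric] intro!: arg_cong2[where f = stage])
    moreover have "\<theta>d K l = (\<lambda>i j a b. K * kA (L-2-l) i j a b + kF (L-2-l) i j a b)" for K
      by (simp add: \<theta>d_def fun_eq_iff)
    ultimately show ?thesis
      using unit_stage[OF v, of _ "L-2-l"]
      unfolding layer_kernel_def ad_def dir_unit_def \<kappa>_def
      by (intro tendsto_prod) simp
  qed
  have "((\<lambda>K. J K h) \<longlongrightarrow> l0 * (\<Prod>l=1..L-2. \<Prod>i=1..n. \<kappa> (L-2-l) i)) at_top"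
  proof -
    have "h (L-1) = stage 0 v" "h L = hid (bl v)" using L(1) by (auto simp: h_def)
    then show ?thesis
      unfolding J_def dbn_joint_def using l0_lim layer by (intro tendsto_mult tendsto_prod) auto
  qed
  \<comment> \<open>Each \<open>s < S\<close> belongs to exactly one pair of step and unit, with its
    time below \<open>L - 2\<close>; grouping by pairs recovers the product over
    \<open>s\<close>.\<close>
  moreover have "(\<Prod>l=1..L-2. \<Prod>i=1..n. \<kappa> (L-2-l) i) = (\<Prod>s<S. ratio v s)"
  proof -
    have "(\<Prod>l=1..L-2. \<Prod>i=1..n. \<kappa> (L-2-l) i) = (\<Prod>\<tau><L-2. \<Prod>i=1..n. \<kappa> \<tau> i)"
      by (rule prod.reindex_bij_witness[where i = "\<lambda>\<tau>. L-2-\<tau>" and j = "\<lambda>l. L-2-l"]) auto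
    also have "\<dots> = (\<Prod>p\<in>{..<L-2} \<times> {1..n}. \<kappa> (fst p) (snd p))"
      by (simp add: prod.cartesian_product case_prod_unfold)
    also have "\<dots> = (\<Prod>p\<in>{..<L-2} \<times> {1..n}. \<Prod>s\<in>{s \<in> {..<S}. (tm s v, crd (bl v) s) = p}. ratio v s)"
      by (simp add: \<kappa>_def)
    also have "\<dots> = (\<Prod>s<S. ratio v s)"
    proof (rule prod.group)
      have "tm s v < L - 2" if "s < S" for s
      proof -
        have "tm s v < (\<Sum>t<Suc s. Q ^ t)" by (rule tm_less[OF v])
        also have "\<dots> \<le> (\<Sum>t<S. Q ^ t)" using that by (intro sum_mono2) auto
        finally show ?thesis using L(2) by simp
      qed
      then show "(\<lambda>s. (tm s v, crd (bl v) s)) ` {..<S} \<subseteq> {..<L-2} \<times> {1..n}"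
        using crd_n by auto
    qed auto
    finally show ?thesis .
  qed
  moreover have "(\<Prod>s<S. ratio v s) = W (D (bl v) S) v / W (D (bl v) 0) v"
    unfolding ratio_def using W_pos[OF v]
    by (intro prod_lessThan_telescope) (auto simp: less_imp_neq[symmetric])
  ultimately have lim: "((\<lambda>K. J K h) \<longlongrightarrow> l0 * (W (D (bl v) S) v / W (D (bl v) 0) v)) at_top"
    by simp
  have "P v / N (bl v) \<le> W (D (bl v) S) v / N (bl v)"
    by (intro divide_right_mono W_ge v) simp
  also have "\<dots> = W (D (bl v) 0) v / N (bl v) * (W (D (bl v) S) v / W (D (bl v) 0) v)"
    using W_pos[OF v, of "D (bl v) 0"] by simp
  also have "\<dots> \<le> l0 * (W (D (bl v) S) v / W (D (bl v) 0) v)"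
    using l0 W_pos[OF v] by (intro mult_right_mono) (auto simp: less_imp_le)
  finally have "c < l0 * (W (D (bl v) S) v / W (D (bl v) 0) v)"
    using less by simp
  from order_tendstoD(1)[OF lim this]
  have "eventually (\<lambda>K. c < dbn_marginal n X L (r_theta K) (\<lambda>_ _. 0) (r_bias K) (\<theta>d K) ad v) at_top"
    by eventually_elim (use J_le in \<open>meson less_le_trans\<close>)
  then show ?thesis unfolding \<theta>d_def ad_def .
qed

end

section \<open>Divergence bounds\<close>

lemma sharing_exists:
  fixes X :: "nat \<Rightarrow> 'a set"
  assumes X: "\<And>i. i \<in> {1..n} \<Longrightarrow> finite (X i) \<and> card (X i) \<ge> 2"
    and blocks: "(\<Prod>j=m+2..n. card (X j)) \<le> m" and m: "m \<le> n" and S: "S \<le> m"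
    and Q: "\<And>i. i \<in> {1..m} \<Longrightarrow> card (X i) \<le> Q"
    and P: "\<And>x. x \<in> states n X \<Longrightarrow> P x > 0" "(\<Sum>x\<in>states n X. P x) = 1"
  shows "\<exists>base alt dig bl. sharing n m S Q X P base alt dig bl"
proof -
  have "\<exists>a a'. a \<in> X i \<and> a' \<in> X i \<and> a' \<noteq> a" if "i \<in> {1..n}" for i
  proof -
    have "\<not> card (X i) \<le> Suc 0" "finite (X i)" using X[OF that] by auto
    then show ?thesis using card_le_Suc0_iff_eq[of "X i"] by blast
  qed
  then obtain base alt where ba: "\<And>i. i \<in> {1..n} \<Longrightarrow> base i \<in> X i \<and> alt i \<in> X i \<and> alt i \<noteq> base i"
    by metis
  have "\<exists>d. inj_on d (X i) \<and> d ` X i \<subseteq> {..<Q}" if "i \<in> {1..m}" for i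
  proof -
    have "finite (X i)" using X[of i] that m by auto
    then obtain d where "bij_betw d (X i) {0..<card (X i)}"
      using ex_bij_betw_finite_nat by blast
    moreover have "{0..<card (X i)} \<subseteq> {..<Q}" using Q[OF that] by auto
    ultimately show ?thesis unfolding bij_betw_def by blast
  qed
  then obtain dig where dig: "\<And>i. i \<in> {1..m} \<Longrightarrow> inj_on (dig i) (X i) \<and> dig i ` X i \<subseteq> {..<Q}"
    by metis
  define B where "B = PiE {m+2..n} X"
  have "finite B" unfolding B_def using X by (intro finite_PiE) auto
  then obtain g where g: "bij_betw g B {0..<card B}"
    using ex_bij_betw_finite_nat by blast
  have card_B: "card B \<le> m" using blocks by (simp add: B_def card_PiE)
  \<comment> \<open>Shifted by one, since block codes are indices in \<open>{1..m}\<close>; the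
    bound on \<open>card B\<close> makes room for all of them.\<close>
  define bl where "bl x = Suc (g (restrict x {m+2..n}))" for x
  have restr: "restrict x {m+2..n} \<in> B" if "x \<in> states n X" for x
    using that unfolding B_def states_def by (auto simp: PiE_iff)
  have bl: "bl x \<in> {1..m}" if "x \<in> states n X" for x
    using bij_betwE[OF g] restr[OF that] card_B by (fastforce simp: bl_def)
  have bl_eq: "bl x = bl y \<longleftrightarrow> (\<forall>i\<in>{m+2..n}. x i = y i)"
    if "x \<in> states n X" "y \<in> states n X" for x y
  proof -
    have "bl x = bl y \<longleftrightarrow> restrict x {m+2..n} = restrict y {m+2..n}"
      using inj_on_eq_iff[OF bij_betw_imp_inj_on[OF g] restr[OF that(1)] restr[OF that(2)]]
      by (simp add: bl_def)
    also have "\<dots> \<longleftrightarrow> (\<forall>i\<in>{m+2..n}. x i = y i)"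
      by (auto simp: fun_eq_iff restrict_def)
    finally show ?thesis .
  qed
  have "sharing n m S Q X P base alt dig bl"
    by unfold_locales (use X ba dig bl bl_eq m S P in \<open>blast+\<close>)
  then show ?thesis by blast
qed

lemma dbn_approximation:
  fixes X :: "nat \<Rightarrow> 'a set"
  assumes X: "\<And>i. i \<in> {1..n} \<Longrightarrow> finite (X i) \<and> card (X i) \<ge> 2"
    and blocks: "(\<Prod>j=m+2..n. card (X j)) \<le> m" and m: "m \<le> n" and S: "S \<le> m"
    and anti: "\<And>i j. 1 \<le> i \<Longrightarrow> i \<le> j \<Longrightarrow> j \<le> m \<Longrightarrow> card (X j) \<le> card (X i)"
    and L: "L \<ge> 2" "(\<Sum>t<S. card (X 1) ^ t) \<le> L - 2"
    and p: "set_pmf p \<subseteq> states n X" and \<mu>: "\<mu> > 1"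
  shows "\<exists>q\<in>dbn_model n X L. \<forall>v\<in>states n X.
    pmf q v > 0 \<and> pmf p v \<le> real (\<Prod>j=1..m-S. card (X j)) * \<mu> * pmf q v"
proof -
  let ?C = "\<Prod>j=1..m-S. card (X j)"
  have X': "finite (X i) \<and> X i \<noteq> {}" if "i \<in> {1..n}" for i
    using X[OF that] by auto
  have fin_st: "finite (states n X)" by (rule finite_states[OF X'])
  have ne: "states n X \<noteq> {}" by (rule states_nonempty[OF X'])
  \<comment> \<open>The added mass totals \<open>\<mu> - 1\<close>, so division by
    \<open>\<mu>\<close> renormalises. The smoothing makes \<open>P\<close> positive and strictly
    larger than \<open>pmf p x / \<mu>\<close>, the slack that the limit needs.\<close>
  define \<delta> where "\<delta> = (\<mu> - 1) / card (states n X)"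
  have \<delta>: "\<delta> > 0" using \<mu> fin_st ne by (simp add: \<delta>_def card_gt_0_iff)
  define P where "P x = (pmf p x + \<delta>) / \<mu>" for x
  have "(\<Sum>x\<in>states n X. P x) = ((\<Sum>x\<in>states n X. pmf p x) + card (states n X) * \<delta>) / \<mu>"
    by (simp add: P_def sum.distrib flip: sum_divide_distrib)
  also have "(\<Sum>x\<in>states n X. pmf p x) = 1" by (rule sum_pmf_eq_1[OF fin_st p])
  also have "card (states n X) * \<delta> = \<mu> - 1" using fin_st ne by (simp add: \<delta>_def)
  finally have P_sum: "(\<Sum>x\<in>states n X. P x) = 1" using \<mu> by simp
  have P_pos: "P x > 0" for x
    using \<delta> \<mu> by (simp add: P_def add_nonneg_pos)
  have Q: "card (X i) \<le> card (X 1)" if "i \<in> {1..m}" for i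
    using anti[of 1 i] that by auto
  obtain base alt dig bl where sh: "sharing n m S (card (X 1)) X P base alt dig bl"
    using sharing_exists[OF X blocks m S Q P_pos P_sum] by blast
  interpret sharing n m S "card (X 1)" X P base alt dig bl by (rule sh)
  have C_pos: "?C > 0"
    using X' m S by (intro prod_pos) (auto simp: card_gt_0_iff)
  define \<theta>d where "\<theta>d K l i j a b = K * kA (L-2-l) i j a b + kF (L-2-l) i j a b" for K l i j a b
  define ad where "ad l = k0 (L-2-l)" for l
  define G where "G K = dbn_marginal n X L (r_theta K) (\<lambda>_ _. 0) (r_bias K) (\<theta>d K) ad" for K
  have "eventually (\<lambda>K. \<forall>v\<in>states n X. pmf p v / (?C * \<mu>) < G K v) at_top"
  proof (rule eventually_ball_finite[OF fin_st], rule ballI)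
    fix v assume v: "v \<in> states n X"
    have "card ({1..m} - A (bl v)) = m - S"
      using A_subset[of "bl v"] card_A[of "bl v"] by (subst card_Diff_subset) (auto intro: finite_subset)
    \<comment> \<open>Any \<open>m - S\<close> of the decreasing cardinalities have at most the
      product of the first \<open>m - S\<close>.\<close>
    then have "N (bl v) \<le> ?C"
      unfolding N_def using anti by (intro prod_le_prod_initial[where m = m]) auto
    have "pmf p v / (?C * \<mu>) = pmf p v / \<mu> / ?C" by simp
    also have "\<dots> < P v / ?C"
      unfolding P_def using \<delta> \<mu> C_pos
      by (intro divide_strict_right_mono) (simp_all del: of_nat_prod)
    also have "\<dots> \<le> P v / N (bl v)"
      using \<open>N (bl v) \<le> ?C\<close> N_pos[of "bl v"] P_pos[OF v] C_pos
      by (intro divide_left_mono) (auto simp: less_imp_le simp del: of_nat_prod)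
    finally show "eventually (\<lambda>K. pmf p v / (?C * \<mu>) < G K v) at_top"
      unfolding G_def \<theta>d_def ad_def by (rule marginal_limit[OF v L])
  qed
  then obtain K where K: "\<And>v. v \<in> states n X \<Longrightarrow> pmf p v / (?C * \<mu>) < G K v"
    using eventually_happens'[OF trivial_limit_at_top_linorder] by blast
  obtain q where q: "q \<in> dbn_model n X L" "\<And>v. v \<in> states n X \<Longrightarrow> pmf q v = G K v"
    using dbn_model_ex1[of n X, OF X' L(1)] unfolding G_def by blast
  show ?thesis
  proof (intro bexI[OF _ q(1)] ballI conjI)
    fix v assume v: "v \<in> states n X"
    show "pmf q v > 0"
      using dbn_marginal_pos[of n X, OF X' L(1) v] q(2)[OF v] by (simp add: G_def)
    show "pmf p v \<le> real ?C * \<mu> * pmf q v"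
      using K[OF v] q(2)[OF v] C_pos \<mu>
      by (simp add: pos_divide_less_eq mult.commute less_imp_le del: of_nat_prod)
  qed
qed

text \<open>The likelihood ratio is at most \<open>C\<close> on the support of \<open>p\<close>, and
  averaging its logarithm under \<open>p\<close> keeps the bound.\<close>

lemma kl_div_le:
  assumes b: "b > 1" and A: "finite A" "set_pmf p \<subseteq> A" and C: "C > 0"
    and q: "\<And>x. x \<in> A \<Longrightarrow> pmf q x > 0 \<and> pmf p x \<le> C * pmf q x"
  shows "kl_div b A p q \<le> ereal (log b C)"
proof -
  have "set_pmf p \<subseteq> set_pmf q"
    using A(2) q by (force simp: set_pmf_iff)
  moreover have "(\<Sum>x\<in>A. pmf p x * log b (pmf p x / pmf q x)) \<le> (\<Sum>x\<in>A. pmf p x * log b C)"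
  proof (rule sum_mono)
    fix x assume x: "x \<in> A"
    show "pmf p x * log b (pmf p x / pmf q x) \<le> pmf p x * log b C"
    proof (cases "pmf p x = 0")
      case False
      then have "pmf p x > 0" by (simp add: less_le)
      with q[OF x] b C show ?thesis
        by (intro mult_left_mono) (auto simp: pos_divide_le_eq)
    qed simp
  qed
  moreover have "(\<Sum>x\<in>A. pmf p x * log b C) = log b C"
    using sum_pmf_eq_1[OF A] by (simp flip: sum_distrib_right)
  ultimately show ?thesis by (simp add: kl_div_def)
qed

lemma max_divergence_dbn_le:
  fixes X :: "nat \<Rightarrow> 'a set"
  assumes b: "b > 1" and X: "\<And>i. i \<in> {1..n} \<Longrightarrow> finite (X i) \<and> card (X i) \<ge> 2"
    and blocks: "(\<Prod>j=m+2..n. card (X j)) \<le> m" and m: "m \<le> n" and S: "S \<le> m"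
    and anti: "\<And>i j. 1 \<le> i \<Longrightarrow> i \<le> j \<Longrightarrow> j \<le> m \<Longrightarrow> card (X j) \<le> card (X i)"
    and L: "L \<ge> 2" "(\<Sum>t<S. card (X 1) ^ t) \<le> L - 2"
  shows "max_divergence b (states n X) (dbn_model n X L) \<le> ereal (log b (real (\<Prod>j=1..m-S. card (X j))))"
  unfolding max_divergence_def
proof (rule SUP_least)
  let ?C = "\<Prod>j=1..m-S. card (X j)"
  have X': "finite (X i) \<and> X i \<noteq> {}" if "i \<in> {1..n}" for i
    using X[OF that] by auto
  have C_pos: "real ?C > 0"
    using X' m S by (subst of_nat_0_less_iff, intro prod_pos) (auto simp: card_gt_0_iff)
  fix p assume "p \<in> {p. set_pmf p \<subseteq> states n X}"
  then have p: "set_pmf p \<subseteq> states n X" by simp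
  show "div_from_model b (states n X) p (dbn_model n X L) \<le> ereal (log b (real ?C))"
  proof (rule ereal_le_epsilon2)
    fix \<epsilon> :: real assume \<epsilon>: "0 < \<epsilon>"
    \<comment> \<open>The choice \<open>\<mu> = b powr \<epsilon>\<close> adds exactly
      \<open>\<epsilon>\<close> to the logarithm.\<close>
    then have "b powr \<epsilon> > 1" using b by (simp add: gr_one_powr)
    from dbn_approximation[OF X blocks m S anti L p this] obtain q
      where q: "q \<in> dbn_model n X L"
        "\<And>v. v \<in> states n X \<Longrightarrow> pmf q v > 0 \<and> pmf p v \<le> real ?C * b powr \<epsilon> * pmf q v"
      by blast
    have "div_from_model b (states n X) p (dbn_model n X L) \<le> kl_div b (states n X) p q"
      unfolding div_from_model_def using q(1) by (rule INF_lower)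
    also have "\<dots> \<le> ereal (log b (real ?C * b powr \<epsilon>))"
      using b C_pos q(2) by (intro kl_div_le finite_states[of n X, OF X'] p) auto
    also have "log b (real ?C * b powr \<epsilon>) = log b (real ?C) + \<epsilon>"
      using b C_pos by (subst log_mult) (auto simp del: of_nat_prod)
    finally show "div_from_model b (states n X) p (dbn_model n X L) \<le> ereal (log b (real ?C)) + ereal \<epsilon>"
      by simp
  qed
qed

theorem theorem3:
  fixes b :: real
  assumes "b > 1"
  shows
    "(\<forall>(n::nat) (L::nat) (m::nat) (S::nat) (q :: nat \<Rightarrow> nat) (X :: nat \<Rightarrow> 'a set).
        (\<forall>i\<in>{1..n}. finite (X i) \<and> card (X i) = q i \<and> q i \<ge> 2) \<longrightarrow>
        (\<Prod>j=m+2..n. q j) \<le> m \<longrightarrow> m \<le> n \<longrightarrow>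
        (\<forall>i j. 1 \<le> i \<longrightarrow> i \<le> j \<longrightarrow> j \<le> m \<longrightarrow> q j \<le> q i) \<longrightarrow>
        S \<le> m \<longrightarrow>
        real L \<ge> 2 + (real (q 1) ^ S - 1) / (real (q 1) - 1) \<longrightarrow>
        max_divergence b (states n X) (dbn_model n X L)
          \<le> ereal (log b (real (\<Prod>j=1..m-S. q j))))
   \<and> (\<forall>(k::nat) (n::nat) (L::nat) (S::nat) (X :: nat \<Rightarrow> 'a set).
        k \<ge> 1 \<longrightarrow> n = 2 ^ (k - 1) + k \<longrightarrow>
        (\<forall>i\<in>{1..n}. finite (X i) \<and> card (X i) = 2) \<longrightarrow>
        S \<le> 2 ^ (k - 1) \<longrightarrow> L \<ge> 1 + 2 ^ S \<longrightarrow>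
        max_divergence b (states n X) (dbn_model n X L)
          \<le> ereal ((2 ^ (k - 1) - real S) * log b 2))"
proof -
  have general: "max_divergence b (states n X) (dbn_model n X L) \<le> ereal (log b (real (\<Prod>j=1..m-S. q j)))"
    if X: "\<forall>i\<in>{1..n}. finite (X i) \<and> card (X i) = q i \<and> q i \<ge> 2"
      and blocks: "(\<Prod>j=m+2..n. q j) \<le> m" and m: "m \<le> n"
      and anti: "\<forall>i j. 1 \<le> i \<longrightarrow> i \<le> j \<longrightarrow> j \<le> m \<longrightarrow> q j \<le> q i" and S: "S \<le> m"
      and L: "real L \<ge> 2 + (real (q 1) ^ S - 1) / (real (q 1) - 1)"
    for n L m S :: nat and q :: "nat \<Rightarrow> nat" and X :: "nat \<Rightarrow> 'a set"
  proof -
    \<comment> \<open>The product is at least 1, hence so is \<open>m\<close>; thus unit 1 exists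
      and \<open>q 1 \<ge> 2\<close> makes the geometric sum formula valid.\<close>
    have "q j > 0" if "j \<in> {m+2..n}" for j
    proof -
      have "j \<in> {1..n}" using that by simp
      with X have "q j \<ge> 2" by blast
      then show ?thesis by simp
    qed
    then have "(\<Prod>j=m+2..n. q j) > 0" by (intro prod_pos) blast
    with blocks m have n: "1 \<in> {1..n}" unfolding atLeastAtMost_iff by linarith
    have q1: "card (X 1) = q 1" "q 1 \<ge> 2" using X n by blast+
    have "real (\<Sum>t<S. q 1 ^ t) = (real (q 1) ^ S - 1) / (real (q 1) - 1)"
      using q1(2) by (simp add: geometric_sum)
    with L have "real (2 + (\<Sum>t<S. q 1 ^ t)) \<le> real L" by simp
    then have L': "2 + (\<Sum>t<S. q 1 ^ t) \<le> L" by (simp only: of_nat_le_iff)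
    have eq: "(\<Prod>j=m+2..n. card (X j)) = (\<Prod>j=m+2..n. q j)"
        "(\<Prod>j=1..m-S. card (X j)) = (\<Prod>j=1..m-S. q j)"
      using X m by (auto intro!: prod.cong)
    have "max_divergence b (states n X) (dbn_model n X L) \<le> ereal (log b (real (\<Prod>j=1..m-S. card (X j))))"
    proof (rule max_divergence_dbn_le[OF assms])
      show "card (X j) \<le> card (X i)" if "1 \<le> i" "i \<le> j" "j \<le> m" for i j
      proof -
        have "card (X i) = q i" "card (X j) = q j" using X that m by auto
        with anti that show ?thesis by simp
      qed
      show "(\<Sum>t<S. card (X 1) ^ t) \<le> L - 2" using L' q1(1) by simp
    qed (use X blocks m S L' eq in auto)
    then show ?thesis by (simp only: eq)
  qed
  show ?thesis
  proof (intro conjI allI impI)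
    fix k n L S :: nat and X :: "nat \<Rightarrow> 'a set"
    assume k: "k \<ge> 1" and n: "n = 2 ^ (k - 1) + k"
      and X: "\<forall>i\<in>{1..n}. finite (X i) \<and> card (X i) = 2"
      and S: "S \<le> 2 ^ (k - 1)" and L: "L \<ge> 1 + 2 ^ S"
    have "real (1 + 2 ^ S) \<le> real L" using L by (simp only: of_nat_le_iff)
    then have L': "2 + (real 2 ^ S - 1) / (real 2 - 1) \<le> real L" by simp
    \<comment> \<open>With \<open>m = 2 ^ (k - 1)\<close> there remain
      \<open>n - m - 1 = k - 1\<close> binary coordinates, which give exactly \<open>m\<close>
      blocks.\<close>
    have "(\<Prod>j=2 ^ (k - 1) + 2..n. 2) = (2 :: nat) ^ (n - 2 ^ (k - 1) - 1)" by simp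
    then have blocks: "(\<Prod>j=2 ^ (k - 1) + 2..n. 2 :: nat) \<le> 2 ^ (k - 1)" using n by simp
    have "max_divergence b (states n X) (dbn_model n X L) \<le> ereal (log b (real (\<Prod>j=1..2 ^ (k - 1) - S. 2)))"
      by (rule general[where q = "\<lambda>_. 2"]) (use X n blocks S L' in auto)
    moreover have "log b (real (\<Prod>j=1..2 ^ (k - 1) - S. 2)) = (2 ^ (k - 1) - real S) * log b 2"
      using S assms by (simp add: log_nat_power of_nat_diff)
    ultimately show "max_divergence b (states n X) (dbn_model n X L) \<le> ereal ((2 ^ (k - 1) - real S) * log b 2)"
      by simp
  qed (rule general)
qed

end
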